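(* There do not exist two proper real linear subspaces $\mathfrak{H}_0,\mathfrak{H}_1$ of the octonions $\mathbb{O}$ satisfying all three of the following statements: (1) $\mathbb{O}$ admits the splitting $\mathbb{O}=\mathfrak{H}_0\oplus\mathfrak{H}_1$; (2) the octonionic Cauchy integral operator $C_{\mathbb{O}}$ is an isomorphism from $L^p(\mathbb{R}^7,\mathfrak{H}_0)$ onto $H^p(\mathbb{R}^8_+,\mathbb{O})$ for all $1<p<\infty$; (3) if $\mathrm{Tan}$ denotes the projection of $\mathbb{O}=\mathfrak{H}_0\oplus\mathfrak{H}_1$ onto $\mathfrak{H}_0$, then the boundary operator $F\mapsto\mathrm{Tan}(F^+)$ is continuous from $H^p(\mathbb{R}^8_+,\mathbb{O})$ onto $L^p(\mathbb{R}^7,\mathfrak{H}_0)$ for all $1<p<\infty$.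
   Context: $\mathbb{O}$ is the real $8$-dimensional normed division algebra of octonions with standard basis $\mathbf{e}_0=1,\mathbf{e}_1,\dots,\mathbf{e}_7$, where $\mathbf{e}_i\mathbf{e}_j+\mathbf{e}_j\mathbf{e}_i=-2\delta_{ij}$ for $1\le i,j\le7$ (products given by the Fano plane multiplication table). Conjugation: $\overline{x_0+\sum_{j\ge1}x_j\mathbf{e}_j}=x_0-\sum_{j\ge1}x_j\mathbf{e}_j$; inner product $(p,q)=\mathrm{Re}(p\bar q)$, with Euclidean norm $|\cdot|$. Upper half-space: $\mathbb{R}^8_+=\{z=(t,x):t>0,\ x\in\mathbb{R}^7\}$, with $z=(t,x)$ identified with the octonion $t+\sum_{j=1}^7x_j\mathbf{e}_j$, and $\mathbb{R}^7$ identified with $\{t=0\}$, i.e. with the imaginary octonions. A $C^1$ function $F:\mathbb{R}^8_+\to\mathbb{O}$ is (left) octonionic analytic if $DF=\partial F/\partial t+\sum_{j=1}^7\mathbf{e}_j\,\partial F/\partial x_j=0$. For $0<p<\infty$, $H^p(\mathbb{R}^8_+,\mathbb{O})$ is the space of octonionic analytic $F$ on $\mathbb{R}^8_+$ with $$\|F\|_{H^p(\mathbb{R}^8_+,\mathbb{O})}=\sup_{t>0}\Big(\int_{\mathbb{R}^7}|F(t,x)|^p\,dx\Big)^{1/p}<\infty .$$ For $p>1$ each $F\in H^p(\mathbb{R}^8_+,\mathbb{O})$ has a non-tangential limit $F^+(x)$ at almost every $x\in\mathbb{R}^7$, and $F^+\in L^p(\mathbb{R}^7,\mathbb{O})$.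 Octonionic Cauchy integral: for $f\in L^p(\mathbb{R}^7,\mathbb{O})$ and $z\in\mathbb{R}^8_+$, $$C_{\mathbb{O}}f(z)=\frac1{\omega_8}\int_{\mathbb{R}^7}\frac{\overline{z-u}}{|u-z|^8}\,f(u)\,du,$$ with octonionic multiplication, where $\omega_8$ is the surface area of the unit sphere in $\mathbb{R}^8$. "Isomorphism" means isomorphism of Banach spaces (bounded linear bijection with bounded inverse). *)

theory Defs
  imports "HOL-Analysis.Analysis"
begin

section \<open>Octonions\<close>

text \<open>
  The octonion \<open>t + x\<^sub>1 e\<^sub>1 + \<dots> + x\<^sub>7 e\<^sub>7\<close> is the pair \<open>(t, x)\<close>, so that the Euclidean
  structure (norm, inner product, topology, Lebesgue measure) is the one of the library.
  Coordinates are indexed by the type \<open>7\<close>, the integers modulo \<open>7\<close>; the last unit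
  \<open>e\<^sub>7\<close> therefore has index \<open>7 = 0\<close>.
\<close>

type_synonym octonion = "real \<times> (real ^ 7)"

definition oone :: octonion where
  "oone = (1, 0)"

definition ounit :: "7 \<Rightarrow> octonion" where
  "ounit j = (0, axis j 1)"

text \<open>
  The oriented lines of the Fano plane are \<open>{i, i+1, i+3}\<close>, that is
  \<open>e\<^sub>i e\<^sub>i\<^sub>+\<^sub>1 = e\<^sub>i\<^sub>+\<^sub>3\<close>, cyclically, with indices modulo \<open>7\<close>. The three terms of
  coordinate \<open>k\<close> come from the three lines through \<open>k\<close>.
\<close>

definition cross7 :: "real ^ 7 \<Rightarrow> real ^ 7 \<Rightarrow> real ^ 7" where
  "cross7 x y = (\<chi> k.
      (x $ (k + 1) * y $ (k + 3) - x $ (k + 3) * y $ (k + 1))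
    + (x $ (k + 2) * y $ (k + 6) - x $ (k + 6) * y $ (k + 2))
    + (x $ (k + 4) * y $ (k + 5) - x $ (k + 5) * y $ (k + 4)))"

definition omult :: "octonion \<Rightarrow> octonion \<Rightarrow> octonion"  (infixl \<open>\<odot>\<close> 70) where
  "p \<odot> q = (fst p * fst q - inner (snd p) (snd q),
            fst p *\<^sub>R snd q + fst q *\<^sub>R snd p + cross7 (snd p) (snd q))"

definition ocnj :: "octonion \<Rightarrow> octonion" where
  "ocnj p = (fst p, - snd p)"

lemma UNIV_7: "(UNIV :: 7 set) = {0, 1, 2, 3, 4, 5, 6}"
proof -
  have "card {0, 1, 2, 3, 4, 5, 6 :: 7} = CARD(7)"
    by simp
  then show ?thesis
    by (metis card_subset_eq finite_class.finite_UNIV subset_UNIV)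
qed

lemma forall_7: "(\<forall>i :: 7. P i) \<longleftrightarrow> P 0 \<and> P 1 \<and> P 2 \<and> P 3 \<and> P 4 \<and> P 5 \<and> P 6"
  by (metis (full_types) UNIV_7 UNIV_I empty_iff insert_iff)

lemma sum_7: "sum f (UNIV :: 7 set) = f 0 + f 1 + f 2 + f 3 + f 4 + f 5 + f 6"
  unfolding UNIV_7 by (simp add: add.assoc)

lemma numeral_mod_7:
  "(7 :: 7) = 0" "(8 :: 7) = 1" "(9 :: 7) = 2" "(10 :: 7) = 3" "(11 :: 7) = 4" "(12 :: 7) = 5"
  by simp_all

lemma ounit_mult_next: "ounit i \<odot> ounit (i + 1) = ounit (i + 3)"
proof -
  have "\<forall>i. ounit i \<odot> ounit (i + 1) = ounit (i + 3)"
    by (simp add: forall_7 ounit_def omult_def cross7_def vec_eq_iff axis_def inner_vec_def sum_7 numeral_mod_7)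
  then show ?thesis ..
qed

lemma ounit_anticommute:
  "ounit i \<odot> ounit j + ounit j \<odot> ounit i = (if i = j then - 2 else 0) *\<^sub>R oone"
proof -
  have "\<forall>i j. ounit i \<odot> ounit j + ounit j \<odot> ounit i = (if i = j then - 2 else 0) *\<^sub>R oone"
    by (auto simp: ounit_def omult_def cross7_def oone_def vec_eq_iff inner_axis_axis)
  then show ?thesis by blast
qed

lemma inner_octonion: "inner p q = fst (p \<odot> ocnj q)"
  by (simp add: omult_def ocnj_def inner_prod_def)

lemma norm_omult: "norm (p \<odot> q) = norm p * norm q"
proof -
  have "(norm (p \<odot> q))\<^sup>2 = (norm p * norm q)\<^sup>2"
    unfolding power_mult_distrib power2_norm_eq_inner
    by (simp add: omult_def cross7_def inner_prod_def inner_vec_def sum_7 numeral_mod_7) algebra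
  then show ?thesis
    by (simp add: power2_eq_iff_nonneg)
qed


section \<open>Lebesgue and Hardy spaces\<close>

definition Lp_norm :: "real \<Rightarrow> (real ^ 7 \<Rightarrow> octonion) \<Rightarrow> real" where
  "Lp_norm p f = (LINT x|lebesgue. norm (f x) powr p) powr (1 / p)"

text \<open>
  The elements of the following set are functions; the members of the Banach space
  \<open>L\<^sup>p(\<real>\<^sup>7, H)\<close> are their classes modulo equality almost everywhere.
\<close>

definition Lp_space :: "real \<Rightarrow> octonion set \<Rightarrow> (real ^ 7 \<Rightarrow> octonion) set" where
  "Lp_space p H = {f. f \<in> borel_measurable lebesgue \<and> (AE x in lebesgue. f x \<in> H) \<and>
     integrable lebesgue (\<lambda>x. norm (f x) powr p)}"

definition ae_equal :: "(real ^ 7 \<Rightarrow> octonion) \<Rightarrow> (real ^ 7 \<Rightarrow> octonion) \<Rightarrow> bool" where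
  "ae_equal f g \<longleftrightarrow> (AE x in lebesgue. f x = g x)"

definition upper_half :: "octonion set" where
  "upper_half = {z. fst z > 0}"

definition C1_on :: "octonion set \<Rightarrow> (octonion \<Rightarrow> octonion) \<Rightarrow> bool" where
  "C1_on S F \<longleftrightarrow> (\<exists>F' :: octonion \<Rightarrow> octonion \<Rightarrow>\<^sub>L octonion.
     (\<forall>z\<in>S. (F has_derivative blinfun_apply (F' z)) (at z)) \<and> continuous_on S F')"

definition dirac :: "(octonion \<Rightarrow> octonion) \<Rightarrow> octonion \<Rightarrow> octonion" where
  "dirac F z = frechet_derivative F (at z) oone
     + (\<Sum>j\<in>UNIV. ounit j \<odot> frechet_derivative F (at z) (ounit j))"

definition oct_analytic :: "(octonion \<Rightarrow> octonion) \<Rightarrow> bool" where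
  "oct_analytic F \<longleftrightarrow> C1_on upper_half F \<and> (\<forall>z\<in>upper_half. dirac F z = 0)"

text \<open>
  Functions on the half-space are total functions of which only the values on
  \<^const>\<open>upper_half\<close> matter, hence equality in the Hardy space is equality there.
  Finiteness of the supremum defining the norm is expressed by finiteness of each
  integral together with boundedness in \<open>t\<close>.
\<close>

definition Hp_space :: "real \<Rightarrow> (octonion \<Rightarrow> octonion) set" where
  "Hp_space p = {F. oct_analytic F \<and>
     (\<forall>t>0. integrable lebesgue (\<lambda>x. norm (F (t, x)) powr p)) \<and>
     bdd_above ((\<lambda>t. Lp_norm p (\<lambda>x. F (t, x))) ` {0<..})}"

definition Hp_norm :: "real \<Rightarrow> (octonion \<Rightarrow> octonion) \<Rightarrow> real" where
  "Hp_norm p F = (SUP t\<in>{0<..}. Lp_norm p (\<lambda>x. F (t, x)))"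

definition half_equal :: "(octonion \<Rightarrow> octonion) \<Rightarrow> (octonion \<Rightarrow> octonion) \<Rightarrow> bool" where
  "half_equal F G \<longleftrightarrow> (\<forall>z\<in>upper_half. F z = G z)"


section \<open>Cauchy integral and boundary values\<close>

text \<open>The surface measure on the unit sphere, as the normalised volume of the cone over a set.\<close>

definition sphere_measure :: "'a::euclidean_space set \<Rightarrow> real" where
  "sphere_measure A =
     real DIM('a) * measure lebesgue {r *\<^sub>R x | r x. 0 < r \<and> r \<le> 1 \<and> x \<in> A}"

definition omega8 :: real where
  "omega8 = sphere_measure (sphere (0 :: octonion) 1)"

definition cauchy_integral :: "(real ^ 7 \<Rightarrow> octonion) \<Rightarrow> octonion \<Rightarrow> octonion" where
  "cauchy_integral f z = (1 / omega8) *\<^sub>R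
     (LINT u|lebesgue. ((1 / norm ((0, u) - z) ^ 8) *\<^sub>R ocnj (z - (0, u))) \<odot> f u)"

definition nt_cone :: "real \<Rightarrow> real ^ 7 \<Rightarrow> octonion set" where
  "nt_cone \<alpha> x = {(t, y) | t y. t > 0 \<and> norm (y - x) < \<alpha> * t}"

definition has_nt_limit :: "(octonion \<Rightarrow> octonion) \<Rightarrow> real ^ 7 \<Rightarrow> octonion \<Rightarrow> bool" where
  "has_nt_limit F x l \<longleftrightarrow> (\<forall>\<alpha>>0. (F \<longlongrightarrow> l) (at (0, x) within nt_cone \<alpha> x))"

text \<open>
  The value is unspecified at the points without a non-tangential limit; for \<open>F\<close> in a Hardy
  space with \<open>p > 1\<close> they form a null set.
\<close>

definition boundary_value :: "(octonion \<Rightarrow> octonion) \<Rightarrow> real ^ 7 \<Rightarrow> octonion" where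
  "boundary_value F x = (THE l. has_nt_limit F x l)"


section \<open>Isomorphisms, splittings and projections\<close>

text \<open>
  An operator \<open>T\<close> between two spaces of functions, with carriers \<open>V\<close> and \<open>W\<close>, norms \<open>N\<close> and
  \<open>M\<close>, whose elements are identified by \<open>E\<close> and \<open>E'\<close> respectively, induces an isomorphism of
  normed spaces: a bounded linear bijection with bounded inverse.
\<close>

definition normed_isomorphism ::
  "('a \<Rightarrow> 'v::real_vector) set \<Rightarrow> (('a \<Rightarrow> 'v) \<Rightarrow> ('a \<Rightarrow> 'v) \<Rightarrow> bool) \<Rightarrow> (('a \<Rightarrow> 'v) \<Rightarrow> real) \<Rightarrow>
   ('b \<Rightarrow> 'w::real_vector) set \<Rightarrow> (('b \<Rightarrow> 'w) \<Rightarrow> ('b \<Rightarrow> 'w) \<Rightarrow> bool) \<Rightarrow> (('b \<Rightarrow> 'w) \<Rightarrow> real) \<Rightarrow>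
   (('a \<Rightarrow> 'v) \<Rightarrow> ('b \<Rightarrow> 'w)) \<Rightarrow> bool"
where
  "normed_isomorphism V E N W E' M T \<longleftrightarrow>
     (\<forall>f\<in>V. T f \<in> W) \<and>
     (\<forall>f\<in>V. \<forall>g\<in>V. E f g \<longleftrightarrow> E' (T f) (T g)) \<and>
     (\<forall>f\<in>V. \<forall>g\<in>V. E' (T (\<lambda>x. f x + g x)) (\<lambda>z. T f z + T g z)) \<and>
     (\<forall>f\<in>V. \<forall>c::real. E' (T (\<lambda>x. c *\<^sub>R f x)) (\<lambda>z. c *\<^sub>R T f z)) \<and>
     (\<forall>F\<in>W. \<exists>f\<in>V. E' (T f) F) \<and>
     (\<exists>K. \<forall>f\<in>V. M (T f) \<le> K * N f) \<and>
     (\<exists>K. \<forall>f\<in>V. N f \<le> K * M (T f))"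

definition continuous_onto ::
  "('a \<Rightarrow> 'v::real_vector) set \<Rightarrow> (('a \<Rightarrow> 'v) \<Rightarrow> real) \<Rightarrow>
   ('b \<Rightarrow> 'w::real_vector) set \<Rightarrow> (('b \<Rightarrow> 'w) \<Rightarrow> ('b \<Rightarrow> 'w) \<Rightarrow> bool) \<Rightarrow> (('b \<Rightarrow> 'w) \<Rightarrow> real) \<Rightarrow>
   (('a \<Rightarrow> 'v) \<Rightarrow> ('b \<Rightarrow> 'w)) \<Rightarrow> bool"
where
  "continuous_onto V N W E' M T \<longleftrightarrow>
     (\<forall>f\<in>V. T f \<in> W) \<and>
     (\<forall>f\<in>V. \<forall>\<epsilon>>0. \<exists>\<delta>>0. \<forall>g\<in>V. N (\<lambda>x. g x - f x) < \<delta> \<longrightarrow> M (\<lambda>y. T g y - T f y) < \<epsilon>) \<and>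
     (\<forall>F\<in>W. \<exists>f\<in>V. E' (T f) F)"

definition direct_sum :: "octonion set \<Rightarrow> octonion set \<Rightarrow> bool" where
  "direct_sum H0 H1 \<longleftrightarrow> (\<forall>w. \<exists>a\<in>H0. \<exists>b\<in>H1. w = a + b) \<and> H0 \<inter> H1 = {0}"

definition Tan :: "octonion set \<Rightarrow> octonion set \<Rightarrow> octonion \<Rightarrow> octonion" where
  "Tan H0 H1 w = (THE a. a \<in> H0 \<and> (\<exists>b\<in>H1. w = a + b))"

end

theory Submission
  imports Defs "HOL-Complex_Analysis.Cauchy_Integral_Theorem"
begin

text \<open>
  Only condition (2) with \<open>p = 2\<close> matters. A subspace \<open>H0\<close> either lies in a real line \<open>\<real> b\<close> or contains
  an orthonormal pair \<open>a\<close>, \<open>b\<close>.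

  If \<open>H0\<close> lies in \<open>\<real> b\<close>, the Cauchy integral of \<open>\<phi> b\<close>, with \<open>\<phi>\<close> real, is \<open>\<kappa> b\<close> where the
  imaginary part of \<open>\<kappa>\<close> is a gradient in \<open>x\<close> and has no circulation around circles. A translate of the Cauchy kernel
  multiplied by \<open>e b\<close>, with \<open>e\<close> an imaginary unit, lies in the Hardy space but does have circulation, so the
  Cauchy integral is not onto.

  If \<open>a\<close>, \<open>b\<close> are orthonormal in \<open>H0\<close>, then \<open>w = a b\<^sup>-\<^sup>1\<close> is an imaginary unit with \<open>w b = a\<close> and
  \<open>w a = - b\<close>; left multiplication by \<open>w\<close> makes the span of \<open>a\<close> and \<open>b\<close> a complex line. Boundary values
  of functions of \<open>t\<close> and the coordinate \<open>s\<close> along \<open>w\<close> alone that are analytic on the other side,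
  such as \<open>1 / (s + \<i> \<tau>)\<^sup>2\<close>, are killed by the Cauchy integral. Cutting off in the six
  remaining directions leaves an error of norm \<open>O(1 / \<tau>)\<close>, while the functions have norm of order
  \<open>\<tau>\<^sup>-\<^sup>3\<^sup>/\<^sup>2\<close>. As \<open>\<tau>\<close> tends to zero, this contradicts the boundedness of the inverse.
\<close>

section \<open>Lebesgue measure and nonnegative integrals\<close>

text \<open>Why a second direction in \<open>H0\<close> is fatal: write the boundary variable of the
  kernel as \<open>(\<sigma>, v)\<close>, with \<open>\<sigma>\<close> along \<open>w\<close> and
  \<open>v\<close> in the six other directions. Integration over \<open>v\<close> removes the
  transverse part of the kernel by oddness and leaves a multiple of
  \<open>(t - \<i> * \<sigma>) / (t\<^sup>2 + \<sigma>\<^sup>2)\<close>, the planar Cauchy kernel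
  \<open>1 / (t + \<i> * \<sigma>)\<close>, acting on the complex line spanned by \<open>a\<close>
  and \<open>b\<close>. The obstacle is that planar functions do not decay in \<open>v\<close> and
  so are not square integrable on R^7; the error of a cut-off must be of smaller order than the
  norm. The function \<open>1 / (s + \<i> * \<tau>)\<^sup>2\<close> has L^1 norm of order 1/tau but
  L^2 norm of order tau^(-3/2), so in the error it is measured in L^1 and the kernel in L^2 along
  \<open>\<sigma>\<close>. The latter norm is at most a multiple of |v|^(-13/2), which is integrable
  at infinity in R^6, and the Lipschitz cut-off supplies the factor min(1, |v|) for the origin. With
  the kernel in L^1 along \<open>\<sigma>\<close> the power would be |v|^(-6), which diverges at
  infinity.\<close>

lemma distr_lborel_basis_bij:
  fixes \<pi> :: "'a::euclidean_space \<Rightarrow> 'b::euclidean_space"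
  assumes bij: "bij_betw \<pi> Basis Basis"
  shows "distr lborel borel (\<lambda>x. \<Sum>i\<in>Basis. (x \<bullet> i) *\<^sub>R \<pi> i) = lborel"
proof (rule lborel_eqI[symmetric])
  let ?g = "\<lambda>x. \<Sum>i\<in>Basis. (x \<bullet> i) *\<^sub>R \<pi> i"
  have g: "?g x \<bullet> \<pi> i = x \<bullet> i" if "i \<in> Basis" for x i
  proof -
    have "?g x \<bullet> \<pi> i = (\<Sum>j\<in>Basis. (x \<bullet> j) * (\<pi> j \<bullet> \<pi> i))"
      by (simp add: inner_sum_left)
    also have "\<dots> = (\<Sum>j\<in>Basis. if j = i then x \<bullet> j else 0)"
    proof (rule sum.cong)
      fix j :: 'a assume j: "j \<in> Basis"
      have "\<pi> j \<in> Basis" "\<pi> i \<in> Basis" "\<pi> j = \<pi> i \<longleftrightarrow> j = i"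
        using bij that j by (auto simp: bij_betw_def inj_on_def)
      then show "(x \<bullet> j) * (\<pi> j \<bullet> \<pi> i) = (if j = i then x \<bullet> j else 0)"
        by (simp add: inner_Basis)
    qed simp
    finally show ?thesis using that by simp
  qed
  fix l u :: 'b
  assume le: "\<And>b. b \<in> Basis \<Longrightarrow> l \<bullet> b \<le> u \<bullet> b"
  \<comment> \<open>A relabelling of coordinates pulls a box back to a box with the same side
    lengths, and boxes determine Lebesgue measure.\<close>
  define l' where "l' = (\<Sum>i\<in>Basis. (l \<bullet> \<pi> i) *\<^sub>R i)"
  define u' where "u' = (\<Sum>i\<in>Basis. (u \<bullet> \<pi> i) *\<^sub>R i)"
  have "x \<in> ?g -` box l u \<longleftrightarrow> x \<in> box l' u'" for x
  proof -
    have "x \<in> ?g -` box l u \<longleftrightarrow> (\<forall>b\<in>\<pi> ` Basis. l \<bullet> b < ?g x \<bullet> b \<and> ?g x \<bullet> b < u \<bullet> b)"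
      using bij by (simp add: mem_box bij_betw_def)
    also have "\<dots> \<longleftrightarrow> (\<forall>i\<in>Basis. l \<bullet> \<pi> i < x \<bullet> i \<and> x \<bullet> i < u \<bullet> \<pi> i)"
      using g by auto
    finally show ?thesis by (simp add: mem_box l'_def u'_def)
  qed
  then have eq: "?g -` box l u = box l' u'" by blast
  have "emeasure (distr lborel borel ?g) (box l u) = emeasure lborel (box l' u')"
    by (simp add: emeasure_distr eq)
  also have "\<dots> = ennreal (\<Prod>i\<in>Basis. (u - l) \<bullet> \<pi> i)"
    using le bij by (subst emeasure_lborel_box)
      (auto simp: l'_def u'_def inner_diff_left bij_betw_def)
  also have "(\<Prod>i\<in>Basis. (u - l) \<bullet> \<pi> i) = (\<Prod>b\<in>Basis. (u - l) \<bullet> b)"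
    by (rule prod.reindex_bij_betw[OF bij])
  finally show "emeasure (distr lborel borel ?g) (box l u) = ennreal (\<Prod>b\<in>Basis. (u - l) \<bullet> b)" .
qed simp

lemma distr_lborel_orthogonal_transformation:
  fixes T :: "real ^ 'n::{finite,wellorder} \<Rightarrow> real ^ 'n::_"
  assumes T: "orthogonal_transformation T"
  shows "distr lborel borel T = lborel"
proof (rule lborel_eqI[symmetric])
  fix l u :: "real ^ 'n::_"
  assume le: "\<And>b. b \<in> Basis \<Longrightarrow> l \<bullet> b \<le> u \<bullet> b"
  have T': "orthogonal_transformation (inv T)"
    using T by (rule orthogonal_transformation_inv)
  have meas: "T \<in> borel_measurable borel"
    using T by (intro borel_measurable_continuous_onI)
      (auto simp: orthogonal_transformation_linear linear_continuous_on linear_linear)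
  have eq: "T -` box l u = inv T ` box l u"
    using orthogonal_transformation_bij[OF T] by (simp add: bij_vimage_eq_inv_image)
  have lm: "inv T ` box l u \<in> lmeasurable"
    by (rule measurable_orthogonal_image[OF T']) simp
  have "emeasure lborel (T -` box l u) = emeasure lebesgue (inv T ` box l u)"
    using measurable_sets[OF meas, of "box l u"] by (simp add: eq)
  also have "\<dots> = ennreal (measure lebesgue (inv T ` box l u))"
    using lm by (simp add: emeasure_eq_measure2)
  also have "\<dots> = ennreal (measure lebesgue (box l u))"
    by (simp add: measure_orthogonal_image[OF T'])
  finally have "emeasure lborel (T -` box l u) = ennreal (\<Prod>b\<in>Basis. (u - l) \<bullet> b)"
    using le by (simp add: inner_diff_left)
  then show "emeasure (distr lborel borel T) (box l u) = ennreal (\<Prod>b\<in>Basis. (u - l) \<bullet> b)"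
    using meas by (simp add: emeasure_distr)
qed simp

text \<open>A bijection of the bases identifies the two spaces isometrically, and a rotation then
  carries the image of \<open>(1, 0)\<close> to \<open>w\<close>. Both factors preserve Lebesgue
  measure. The map separates the coordinate along \<open>w\<close> from the transverse ones, so that
  Fubini applies to them.\<close>

lemma obtain_isometry_from_line:
  fixes w :: "real ^ 'n::{finite,wellorder}"
  assumes w: "norm w = 1" and dim: "CARD('n) = Suc DIM('a)"
  obtains L :: "real \<times> 'a::euclidean_space \<Rightarrow> real ^ 'n::_"
  where "linear L" "\<And>x. norm (L x) = norm x" "L (1, 0) = w" "distr lborel borel L = lborel"
proof -
  have "card (Basis :: (real \<times> 'a) set) = card (Basis :: (real ^ 'n::_) set)"
    using dim by simp
  then obtain \<pi> where bij: "bij_betw \<pi> (Basis :: (real \<times> 'a) set) (Basis :: (real ^ 'n::_) set)"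
    by (metis bij_betw_iff_card finite_Basis)
  define g where "g = (\<lambda>x. \<Sum>i\<in>Basis. (x \<bullet> i) *\<^sub>R \<pi> i)"
  have lin_g: "linear g"
    unfolding g_def by (intro linearI) (simp_all add: inner_add_left scaleR_add_left sum.distrib scaleR_sum_right)
  have norm_g: "norm (g x) = norm x" for x
  proof -
    have "g x \<bullet> g x = (\<Sum>i\<in>Basis. \<Sum>j\<in>Basis. (x \<bullet> i) * (x \<bullet> j) * (\<pi> i \<bullet> \<pi> j))"
      unfolding g_def inner_sum_left
      by (simp add: inner_sum_right sum_distrib_left mult.assoc mult.left_commute)
    also have "\<dots> = (\<Sum>i\<in>Basis. \<Sum>j\<in>Basis. if j = i then (x \<bullet> i) * (x \<bullet> j) else 0)"
    proof (intro sum.cong refl)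
      fix i j :: "real \<times> 'a" assume ij: "i \<in> Basis" "j \<in> Basis"
      have "\<pi> j \<in> Basis" "\<pi> i \<in> Basis" "\<pi> i = \<pi> j \<longleftrightarrow> j = i"
        using bij ij by (auto simp: bij_betw_def inj_on_def)
      then show "(x \<bullet> i) * (x \<bullet> j) * (\<pi> i \<bullet> \<pi> j) = (if j = i then (x \<bullet> i) * (x \<bullet> j) else 0)"
        by (simp add: inner_Basis)
    qed
    also have "\<dots> = x \<bullet> x"
      by (simp add: euclidean_inner[of x x])
    finally show ?thesis by (simp add: norm_eq_sqrt_inner)
  qed
  have "norm (g (1, 0)) = norm w"
    by (simp add: norm_g w)
  then obtain T where T: "orthogonal_transformation T" "T (g (1, 0)) = w"
    using orthogonal_transformation_exists by metis
  have dg: "distr lborel borel g = lborel"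
    unfolding g_def by (rule distr_lborel_basis_bij[OF bij])
  have meas: "g \<in> borel_measurable borel" "T \<in> borel_measurable borel"
    using lin_g T by (auto intro!: borel_measurable_continuous_onI
      simp: orthogonal_transformation_linear linear_continuous_on linear_linear)
  have "distr lborel borel (T \<circ> g) = distr (distr lborel borel g) borel T"
    using meas by (simp add: distr_distr)
  then have "distr lborel borel (T \<circ> g) = lborel"
    by (simp add: dg distr_lborel_orthogonal_transformation[OF T(1)])
  then show thesis
    using T lin_g norm_g
    by (intro that[of "T \<circ> g"]) (auto simp: linear_compose orthogonal_transformation)
qed

section \<open>Convergence of power weights, by covering with dyadic balls\<close>

lemma ennreal_term_le_suminf: "f k \<le> (\<Sum>k. f k)" for f :: "nat \<Rightarrow> ennreal"
  using sum_le_suminf[of f "{k}"] by (simp add: summableI)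

text \<open>The ball of radius \<open>\<rho> k\<close> has volume proportional to
  \<open>\<rho> k ^ DIM('a)\<close>, so termwise integration replaces polar coordinates by a
  numerical series, geometric in each use below.\<close>

lemma nn_integral_le_series_of_balls:
  fixes f :: "'a::euclidean_space \<Rightarrow> ennreal" and c \<rho> :: "nat \<Rightarrow> real"
  assumes c: "\<And>k. 0 \<le> c k" and \<rho>: "\<And>k. 0 \<le> \<rho> k"
    and summ: "summable (\<lambda>k. c k * \<rho> k ^ DIM('a))"
    and le: "\<And>v. f v \<le> (\<Sum>k. ennreal (c k) * indicator (cball 0 (\<rho> k)) v)"
  shows "(\<integral>\<^sup>+v. f v \<partial>lborel) < \<infinity>"
proof -
  have "(\<integral>\<^sup>+v. f v \<partial>lborel) \<le> (\<integral>\<^sup>+v. (\<Sum>k. ennreal (c k) * indicator (cball 0 (\<rho> k)) v) \<partial>(lborel :: 'a measure))"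
    by (intro nn_integral_mono) (simp add: le)
  also have "\<dots> = (\<Sum>k. \<integral>\<^sup>+v. ennreal (c k) * indicator (cball 0 (\<rho> k)) v \<partial>(lborel :: 'a measure))"
    by (intro nn_integral_suminf) (auto intro!: borel_measurable_times_ennreal borel_measurable_indicator)
  also have "\<dots> = (\<Sum>k. ennreal (c k * \<rho> k ^ DIM('a) * unit_ball_vol (DIM('a))))"
  proof (rule suminf_cong)
    fix k
    have "(\<integral>\<^sup>+v. ennreal (c k) * indicator (cball 0 (\<rho> k)) v \<partial>(lborel :: 'a measure))
        = ennreal (c k) * emeasure lborel (cball (0 :: 'a) (\<rho> k))"
      by (rule nn_integral_cmult_indicator) simp
    then show "(\<integral>\<^sup>+v. ennreal (c k) * indicator (cball 0 (\<rho> k)) v \<partial>(lborel :: 'a measure))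
        = ennreal (c k * \<rho> k ^ DIM('a) * unit_ball_vol (DIM('a)))"
      using c \<rho> by (simp add: emeasure_cball ennreal_mult[symmetric] mult_ac)
  qed
  also have "\<dots> < \<infinity>"
    using c \<rho> summable_mult2[OF summ]
    by (subst suminf_ennreal2) (simp_all add: mult_nonneg_nonneg)
  finally show ?thesis .
qed

lemma nn_integral_inverse_power_norm_finite:
  "(\<integral>\<^sup>+v. ennreal (1 / (1 + norm v) ^ Suc DIM('a)) \<partial>(lborel :: 'a::euclidean_space measure)) < \<infinity>"
proof (rule nn_integral_le_series_of_balls)
  let ?d = "DIM('a)"
  \<comment> \<open>A point \<open>v\<close> is charged to the least \<open>k\<close> with
    \<open>1 + norm v \<le> 2 ^ k\<close>. By minimality
    \<open>2 ^ k \<le> 2 * (1 + norm v)\<close>, which accounts for the factor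
    \<open>2 ^ Suc ?d\<close>.\<close>
  let ?c = "\<lambda>k. 2 ^ Suc ?d / (2 ^ k) ^ Suc ?d :: real"
  have eq: "?c k * (2 ^ k) ^ ?d = 2 ^ Suc ?d * (1 / 2) ^ k" for k
    by (simp add: field_simps)
  show "summable (\<lambda>k. ?c k * (2 ^ k) ^ ?d)"
    unfolding eq by (intro summable_mult summable_geometric) simp
  show "0 \<le> ?c k" "0 \<le> (2 ^ k :: real)" for k by simp_all
  fix v :: 'a
  obtain k where k: "1 + norm v \<le> 2 ^ k" "\<And>j. j < k \<Longrightarrow> 1 + norm v > 2 ^ j"
  proof -
    have "\<exists>k. 1 + norm v \<le> 2 ^ k"
      by (meson less_imp_le one_less_numeral_iff real_arch_pow semiring_norm(76))
    then show ?thesis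
      using that exists_least_iff[of "\<lambda>k. 1 + norm v \<le> 2 ^ k"] by (metis linorder_not_le)
  qed
  have "2 ^ k \<le> 2 * (1 + norm v)"
    using k(2)[of "k - 1"] by (cases k) auto
  then have "(2 ^ k) ^ Suc ?d \<le> (2 * (1 + norm v)) ^ Suc ?d"
    by (intro power_mono) auto
  have pos: "0 < (1 + norm v) ^ Suc ?d"
    by (rule zero_less_power) (simp add: add_pos_nonneg)
  from \<open>(2 ^ k) ^ Suc ?d \<le> _\<close> have "1 * (2 ^ k) ^ Suc ?d \<le> 2 ^ Suc ?d * (1 + norm v) ^ Suc ?d"
    by (simp only: power_mult_distrib mult_1)
  then have "1 / (1 + norm v) ^ Suc ?d \<le> ?c k"
    using pos by (simp add: divide_simps del: power_Suc)
  moreover have "indicator (cball 0 (2 ^ k)) v = (1 :: ennreal)"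
    using k(1) by (simp add: indicator_def)
  ultimately have "ennreal (1 / (1 + norm v) ^ Suc ?d) \<le> ennreal (?c k) * indicator (cball 0 (2 ^ k)) v"
    by (simp del: power_Suc)
  also have "\<dots> \<le> (\<Sum>k. ennreal (?c k) * indicator (cball 0 (2 ^ k)) v)"
    by (rule ennreal_term_le_suminf)
  finally show "ennreal (1 / (1 + norm v) ^ Suc ?d) \<le> (\<Sum>k. ennreal (?c k) * indicator (cball 0 (2 ^ k)) v)" .
qed

lemma integrable_inverse_power_norm:
  "integrable lborel (\<lambda>v::'a::euclidean_space. 1 / (1 + norm v) ^ Suc DIM('a))"
  using nn_integral_inverse_power_norm_finite[where 'a='a]
  by (intro integrableI_bounded) (simp_all add: abs_of_nonneg)

text \<open>Comparison with the previous weight: with m = min(t, 1), (1 + |v|)^2 <= 2 (1 + |v|^2) <=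
  (2 / m^2) (t^2 + |v|^2), and \<open>2 * n\<close> is at least the dimension plus one.\<close>

lemma integrable_japanese_bracket:
  assumes t: "t > 0" and n: "DIM('a) < 2 * n"
  shows "integrable lborel (\<lambda>v::'a::euclidean_space. 1 / (t\<^sup>2 + (norm v)\<^sup>2) ^ n)"
proof -
  define m where "m = min t 1"
  have m: "0 < m" "m \<le> t" "m \<le> 1" using t by (auto simp: m_def)
  have "integrable lborel (\<lambda>v::'a. (2 / m\<^sup>2) ^ n * (1 / (1 + norm v) ^ Suc DIM('a)))"
    by (intro integrable_mult_right integrable_inverse_power_norm)
  then show ?thesis
  proof (rule Bochner_Integration.integrable_bound)
    show "AE v::'a in lborel. norm (1 / (t\<^sup>2 + (norm v)\<^sup>2) ^ n)
        \<le> norm ((2 / m\<^sup>2) ^ n * (1 / (1 + norm v) ^ Suc DIM('a)))"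
    proof (intro AE_I2)
      fix v :: 'a
      have aux: "1 / T \<le> A * (1 / D)" if "D \<le> A * T" "D > 0" "T > 0" for A D T :: real
        using that by (simp add: field_simps)
      have "(1 + norm v)\<^sup>2 \<le> 2 * (1 + (norm v)\<^sup>2)"
        using zero_le_power2[of "1 - norm v"] by (simp add: power2_eq_square algebra_simps)
      also have "m\<^sup>2 * (2 * (1 + (norm v)\<^sup>2)) \<le> 2 * (t\<^sup>2 + (norm v)\<^sup>2)"
      proof -
        have "m\<^sup>2 \<le> t\<^sup>2" "m\<^sup>2 \<le> 1" using m by (auto intro: power_mono simp: power_le_one)
        then show ?thesis using mult_right_mono[of "m\<^sup>2" 1 "(norm v)\<^sup>2"] by (simp add: algebra_simps)
      qed
      then have "2 * (1 + (norm v)\<^sup>2) \<le> 2 / m\<^sup>2 * (t\<^sup>2 + (norm v)\<^sup>2)"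
        using m by (simp add: field_simps)
      finally have "(1 + norm v) ^ (2 * n) \<le> (2 / m\<^sup>2 * (t\<^sup>2 + (norm v)\<^sup>2)) ^ n"
        unfolding power_mult by (rule power_mono) simp
      moreover have "(1 + norm v) ^ Suc DIM('a) \<le> (1 + norm v) ^ (2 * n)"
        using n by (intro power_increasing) auto
      ultimately have "(1 + norm v) ^ Suc DIM('a) \<le> (2 / m\<^sup>2) ^ n * (t\<^sup>2 + (norm v)\<^sup>2) ^ n"
        by (simp only: power_mult_distrib)
      moreover have "0 < t\<^sup>2 + (norm v)\<^sup>2"
        using t by (simp add: add_pos_nonneg)
      moreover have "0 < (1 + norm v) ^ Suc DIM('a)"
        by (rule zero_less_power) (simp add: add_pos_nonneg)
      ultimately show "norm (1 / (t\<^sup>2 + (norm v)\<^sup>2) ^ n)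
        \<le> norm ((2 / m\<^sup>2) ^ n * (1 / (1 + norm v) ^ Suc DIM('a)))"
        using aux[where D = "(1 + norm v) ^ Suc DIM('a)" and T = "(t\<^sup>2 + (norm v)\<^sup>2) ^ n" and A = "(2 / m\<^sup>2) ^ n"]
        by (simp add: abs_of_nonneg del: power_Suc)
    qed
  qed measurable
qed

text \<open>The weight behaves like \<open>|v|\<close> to the power \<open>- 11/2\<close> at the origin and \<open>- 13/2\<close> at infinity, on the
  two sides of the critical exponent \<open>- 6\<close>.\<close>

lemma nn_integral_critical_weight_finite:
  assumes "DIM('a::euclidean_space) = 6"
  shows "(\<integral>\<^sup>+v. ennreal (min 1 (norm v) / (sqrt (norm v)) ^ 13) \<partial>(lborel :: 'a measure)) < \<infinity>"
proof -
  define w :: "'a \<Rightarrow> real" where "w v = min 1 (norm v) / (sqrt (norm v)) ^ 13" for v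
  have far: "(\<integral>\<^sup>+v. ennreal (w v) * indicator {v. norm v \<ge> 1} v \<partial>lborel) < \<infinity>"
  proof (rule nn_integral_le_series_of_balls)
    \<comment> \<open>The dyadic decomposition is made in r = sqrt |v|, which keeps all exponents
      integral: the weight is r^(-13), the balls have radius 4^k, and the terms decay like 2^(12 k -
      13 k).\<close>
    let ?c = "\<lambda>k. 2 ^ 13 / 2 ^ (13 * k) :: real" and ?\<rho> = "\<lambda>k. 2 ^ (2 * k) :: real"
    have eq: "?c k * ?\<rho> k ^ DIM('a) = 2 ^ 13 * (1 / 2) ^ k" for k
      by (simp add: assms field_simps flip: power_mult power_add)
    show "summable (\<lambda>k. ?c k * ?\<rho> k ^ DIM('a))"
      unfolding eq by (intro summable_mult summable_geometric) simp
    show "0 \<le> ?c k" "0 \<le> ?\<rho> k" for k by simp_all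
    fix v :: 'a
    show "ennreal (w v) * indicator {v. norm v \<ge> 1} v
        \<le> (\<Sum>k. ennreal (?c k) * indicator (cball 0 (?\<rho> k)) v)"
    proof (cases "norm v \<ge> 1")
      case True
      define r where "r = sqrt (norm v)"
      have r: "r \<ge> 1" "norm v = r\<^sup>2" using True by (auto simp: r_def)
      obtain k where k: "r \<le> 2 ^ k" "\<And>j. j < k \<Longrightarrow> r > 2 ^ j"
      proof -
        have "\<exists>k. r \<le> 2 ^ k"
          by (meson less_imp_le one_less_numeral_iff real_arch_pow semiring_norm(76))
        then show ?thesis
          using that exists_least_iff[of "\<lambda>k. r \<le> 2 ^ k"] by (metis linorder_not_le)
      qed
      have "2 ^ k \<le> 2 * r"
        using k(2)[of "k - 1"] r by (cases k) auto
      then have "(2 ^ k) ^ 13 \<le> (2 * r) ^ 13"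
        by (intro power_mono) auto
      moreover have "(2 ^ k) ^ 13 = (2 ^ (13 * k) :: real)"
        by (simp add: mult.commute flip: power_mult)
      ultimately have "1 / r ^ 13 \<le> ?c k"
        using r by (simp add: field_simps power_mult_distrib)
      moreover have "w v = 1 / r ^ 13"
        using True by (simp add: w_def r_def)
      moreover have "norm v \<le> ?\<rho> k"
        using power_mono[OF k(1), of 2] r by (simp add: mult.commute flip: power_mult)
      ultimately have "ennreal (w v) * indicator {v. norm v \<ge> 1} v
          \<le> ennreal (?c k) * indicator (cball 0 (?\<rho> k)) v"
        by (simp add: indicator_def ennreal_leI)
      also have "\<dots> \<le> (\<Sum>k. ennreal (?c k) * indicator (cball 0 (?\<rho> k)) v)"
        by (rule ennreal_term_le_suminf)
      finally show ?thesis .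
    qed simp
  qed
  have near: "(\<integral>\<^sup>+v. ennreal (w v) * indicator {v. norm v < 1} v \<partial>lborel) < \<infinity>"
  proof (rule nn_integral_le_series_of_balls)
    \<comment> \<open>Below radius 1 the weight is r^(-11) and the balls of radius 4^(-k) give terms
      of order 2^(11 k - 12 k). At the origin the quotient is \<open>0 / 0 = 0\<close>, so that
      point is treated apart.\<close>
    let ?c = "\<lambda>k. 2 ^ 11 * 2 ^ (11 * k) :: real" and ?\<rho> = "\<lambda>k. 1 / 2 ^ (2 * k) :: real"
    have eq: "?c k * ?\<rho> k ^ DIM('a) = 2 ^ 11 * (1 / 2) ^ k" for k
      by (simp add: assms field_simps flip: power_mult power_add)
    show "summable (\<lambda>k. ?c k * ?\<rho> k ^ DIM('a))"
      unfolding eq by (intro summable_mult summable_geometric) simp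
    show "0 \<le> ?c k" "0 \<le> ?\<rho> k" for k by simp_all
    fix v :: 'a
    show "ennreal (w v) * indicator {v. norm v < 1} v
        \<le> (\<Sum>k. ennreal (?c k) * indicator (cball 0 (?\<rho> k)) v)"
    proof (cases "norm v < 1 \<and> v \<noteq> 0")
      case True
      define r where "r = sqrt (norm v)"
      have r: "0 < r" "r < 1" "norm v = r\<^sup>2" using True by (auto simp: r_def)
      obtain k where k: "1 / r < 2 ^ Suc k" "2 ^ k \<le> 1 / r"
      proof -
        have ex: "\<exists>k. 1 / r < 2 ^ k"
          by (simp add: real_arch_pow)
        define n where "n = (LEAST k. 1 / r < 2 ^ k)"
        have "1 / r < 2 ^ n" unfolding n_def using ex by (rule LeastI_ex)
        moreover have "n \<noteq> 0" using \<open>1 / r < 2 ^ n\<close> r by (intro notI) (simp add: field_simps)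
        moreover have "\<not> 1 / r < 2 ^ (n - 1)"
          using \<open>n \<noteq> 0\<close> unfolding n_def by (intro not_less_Least) (simp add: n_def)
        ultimately show ?thesis by (intro that[of "n - 1"]) auto
      qed
      have "(1 / r) ^ 11 \<le> (2 ^ Suc k) ^ 11"
        using k r by (intro power_mono) auto
      also have "(2 ^ Suc k) ^ 11 = ?c k"
        by (simp add: power_mult_distrib mult.commute flip: power_mult)
      finally have "(1 / r) ^ 11 \<le> ?c k" .
      moreover have "w v = (1 / r) ^ 11"
      proof -
        have "w v = norm v / r ^ 13" using True by (simp add: w_def r_def)
        also have "\<dots> = r\<^sup>2 / r ^ 13" by (simp only: r)
        also have "\<dots> = (1 / r) ^ 11"
          using r(1) by (simp add: power_divide divide_simps flip: power_add)
        finally show ?thesis .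
      qed
      moreover have "norm v \<le> ?\<rho> k"
      proof -
        have "r \<le> 1 / 2 ^ k" using k(2) r(1) by (simp add: field_simps)
        from power_mono[OF this, of 2] have "r\<^sup>2 \<le> (1 / 2 ^ k)\<^sup>2" using r(1) by simp
        then show ?thesis
          unfolding r(3) by (simp add: power_divide mult.commute flip: power_mult)
      qed
      ultimately have "ennreal (w v) * indicator {v. norm v < 1} v
          \<le> ennreal (?c k) * indicator (cball 0 (?\<rho> k)) v"
        by (simp add: indicator_def ennreal_leI)
      also have "\<dots> \<le> (\<Sum>k. ennreal (?c k) * indicator (cball 0 (?\<rho> k)) v)"
        by (rule ennreal_term_le_suminf)
      finally show ?thesis .
    qed (auto simp: w_def)
  qed
  have meas [measurable]: "w \<in> borel_measurable borel"
    unfolding w_def[abs_def] by measurable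
  have "(\<integral>\<^sup>+v. ennreal (w v) \<partial>lborel) = (\<integral>\<^sup>+v. ennreal (w v) * indicator {v. norm v \<ge> 1} v
      + ennreal (w v) * indicator {v. norm v < 1} v \<partial>lborel)"
    by (intro nn_integral_cong) (auto simp: indicator_def)
  also have "\<dots> < \<infinity>"
    using far near by (subst nn_integral_add) auto
  finally show ?thesis unfolding w_def .
qed

text \<open>Extended nonnegative values allow its use before finiteness is known. If one factor on
  the right is 0, the corresponding function vanishes almost everywhere; if neither is 0 and one is
  infinite, the right side is infinite.\<close>

lemma Cauchy_Schwarz_nn_integral:
  assumes [measurable]: "f \<in> borel_measurable M" "g \<in> borel_measurable M"
  shows "(\<integral>\<^sup>+x. f x * g x \<partial>M)\<^sup>2 \<le> (\<integral>\<^sup>+x. (f x)\<^sup>2 \<partial>M) * (\<integral>\<^sup>+x. (g x)\<^sup>2 \<partial>M)"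
proof -
  let ?A = "\<integral>\<^sup>+x. (f x)\<^sup>2 \<partial>M" and ?B = "\<integral>\<^sup>+x. (g x)\<^sup>2 \<partial>M"
  show ?thesis
  proof (cases "?A = 0 \<or> ?B = 0")
    case True
    then have "(AE x in M. f x = 0) \<or> (AE x in M. g x = 0)"
      by (simp add: nn_integral_0_iff_AE)
    then have "AE x in M. f x * g x = 0"
      by auto
    then have "(\<integral>\<^sup>+x. f x * g x \<partial>M) = 0"
      by (simp add: nn_integral_0_iff_AE)
    then show ?thesis by simp
  next
    case nz: False
    show ?thesis
    proof (cases "?A = top \<or> ?B = top")
      case True
      with nz have "?A * ?B = top" by (auto simp: ennreal_mult_eq_top_iff)
      then show ?thesis by simp
    next
      case False
      then obtain A B where AB: "?A = ennreal A" "?B = ennreal B" "A \<ge> 0" "B \<ge> 0"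
        by (metis ennreal_cases)
      with nz have pos: "A > 0" "B > 0" by auto
      define a b where "a = sqrt A" and "b = sqrt B"
      have ab: "a > 0" "b > 0" "a\<^sup>2 = A" "b\<^sup>2 = B" using pos by (auto simp: a_def b_def)
      \<comment> \<open>The weights are balanced so that, with the square integrals equal to
        \<open>a\<^sup>2\<close> and \<open>b\<^sup>2\<close>, each term integrates to
        \<open>a * b / 2\<close>.\<close>
      have young: "u * v \<le> ennreal (b / (2 * a)) * u\<^sup>2 + ennreal (a / (2 * b)) * v\<^sup>2" for u v :: ennreal
      proof (cases "u = top \<or> v = top")
        case True
        then show ?thesis using ab
          by (auto simp: ennreal_mult_top ennreal_mult_eq_top_iff power2_eq_square top_unique)
      next
        case False
        then obtain u' v' where uv: "u = ennreal u'" "v = ennreal v'" "u' \<ge> 0" "v' \<ge> 0"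
          by (metis ennreal_cases)
        have "0 \<le> (b * u' - a * v')\<^sup>2" by simp
        then have "u' * v' \<le> b / (2 * a) * u'\<^sup>2 + a / (2 * b) * v'\<^sup>2"
          using ab by (simp add: field_simps power2_eq_square)
        then show ?thesis
          using uv ab by (simp add: ennreal_power ennreal_leI flip: ennreal_mult ennreal_plus)
      qed
      have "(\<integral>\<^sup>+x. f x * g x \<partial>M)
          \<le> (\<integral>\<^sup>+x. ennreal (b / (2 * a)) * (f x)\<^sup>2 + ennreal (a / (2 * b)) * (g x)\<^sup>2 \<partial>M)"
        by (intro nn_integral_mono young)
      also have "\<dots> = ennreal (b / (2 * a)) * ?A + ennreal (a / (2 * b)) * ?B"
        by (simp add: nn_integral_add nn_integral_cmult)
      also have "\<dots> = ennreal (a * b)"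
        using ab AB by (simp add: power2_eq_square flip: ennreal_mult ennreal_plus)
          (auto simp: field_simps power2_eq_square)
      finally have "(\<integral>\<^sup>+x. f x * g x \<partial>M)\<^sup>2 \<le> (ennreal (a * b))\<^sup>2"
        by (intro power_mono) auto
      also have "\<dots> = ?A * ?B"
        using ab AB by (simp add: ennreal_power power_mult_distrib flip: ennreal_mult)
      finally show ?thesis .
    qed
  qed
qed

text \<open>Close the segment from -n to n by the lower semicircle. Cauchy's theorem applies in the
  convex region, and the arc contributes at most pi n times C / n^2, which tends to 0.\<close>

lemma integral_real_line_eq_0:
  fixes f :: "complex \<Rightarrow> complex"
  assumes hol: "f holomorphic_on {z. Im z < c}" and c: "c > 0"
    and bound: "\<And>z. Im z \<le> 0 \<Longrightarrow> norm z \<ge> R0 \<Longrightarrow> norm (f z) \<le> C / (norm z)\<^sup>2"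
    and int: "integrable lborel (\<lambda>x. f (complex_of_real x))"
  shows "(LINT x|lborel. f (complex_of_real x)) = 0"
proof -
  define I where "I n = (LINT x|lborel. indicator {- real n..real n} x *\<^sub>R f (complex_of_real x))" for n
  have lim: "I \<longlonglongrightarrow> (LINT x|lborel. f (complex_of_real x))"
    unfolding I_def
  proof (rule integral_dominated_convergence[where w = "\<lambda>x. norm (f (complex_of_real x))"])
    show "AE x in lborel. (\<lambda>n. indicator {- real n..real n} x *\<^sub>R f (complex_of_real x)) \<longlonglongrightarrow> f (complex_of_real x)"
    proof (intro AE_I2 tendsto_eventually)
      fix x :: real
      obtain N where "\<bar>x\<bar> \<le> real N" using real_arch_simple by blast
      then have "indicator {- real n..real n} x = (1::real)" if "n \<ge> N" for n
        using that by (auto simp: indicator_def)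
      then show "eventually (\<lambda>n. indicator {- real n..real n} x *\<^sub>R f (complex_of_real x) = f (complex_of_real x)) sequentially"
        unfolding eventually_sequentially by (metis scaleR_one)
    qed
  qed (use int in \<open>auto simp: indicator_def\<close>)
  have I_bound: "norm (I n) \<le> C * pi * inverse (real n)" if n: "n \<ge> 1" "real n \<ge> R0" for n
  proof -
    let ?R = "complex_of_real (real n)"
    let ?S = "{z. Im z < c}"
    \<comment> \<open>The decreasing angle leads from n through -n i to -n, so the arc stays in the
      lower half-plane and closes the segment.\<close>
    let ?arc = "part_circlepath 0 (real n) 0 (- pi)"
    have arc: "path_image ?arc \<subseteq> {z. Im z \<le> 0 \<and> norm z = real n}"
    proof
      fix z assume "z \<in> path_image ?arc"
      then obtain x where x: "z = real n * cis x" "- pi \<le> x" "x \<le> 0"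
      proof -
        obtain x where "x \<in> closed_segment 0 (- pi)" "z = real n * cis x"
          using \<open>z \<in> path_image ?arc\<close> path_image_part_circlepath'[of 0 "real n" 0 "- pi"] by auto
        moreover have "closed_segment 0 (- pi) = {- pi..0}"
          using pi_gt_zero by (simp add: closed_segment_eq_real_ivl not_le)
        ultimately show ?thesis using that by auto
      qed
      have "sin x \<le> 0" using sin_ge_zero[of "- x"] x by simp
      then have "Im z \<le> 0" using x by (simp add: mult_nonneg_nonpos)
      moreover have "norm z = real n" using x by (simp add: norm_mult)
      ultimately show "z \<in> {z. Im z \<le> 0 \<and> norm z = real n}" by simp
    qed
    have line: "closed_segment (- ?R) ?R \<subseteq> ?S"
      using c by (auto simp: closed_segment_def)
    have ends: "pathstart ?arc = ?R" "pathfinish ?arc = - ?R"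
      by (simp_all add: exp_minus flip: exp_of_real)
    have open_S: "open ?S" and convex_S: "convex ?S"
      by (simp_all add: open_halfspace_Im_lt convex_halfspace_Im_lt)
    let ?g = "linepath (- ?R) ?R +++ ?arc"
    have "(f has_contour_integral 0) ?g"
      using line arc c ends
      by (intro Cauchy_theorem_convex_simple[OF hol convex_S])
         (auto simp: path_image_join intro!: valid_path_join)
    moreover have "f contour_integrable_on linepath (- ?R) ?R" "f contour_integrable_on ?arc"
      using line arc c holomorphic_on_imp_continuous_on[OF hol]
      by (auto intro!: contour_integrable_holomorphic_simple[OF hol open_S])
    ultimately have sum0: "contour_integral (linepath (- ?R) ?R) f + contour_integral ?arc f = 0"
      using ends by (metis contour_integral_join contour_integral_unique pathfinish_linepath valid_path_linepath valid_path_part_circlepath)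
    have "norm (contour_integral ?arc f) \<le> C / (real n)\<^sup>2 * real n * \<bar>- pi - 0\<bar>"
    proof (rule contour_integral_bound_part_circlepath)
      show "f contour_integrable_on ?arc" by fact
      show "0 \<le> C / (real n)\<^sup>2"
        using bound[of "- \<i> * real n"] n by (auto simp: norm_mult intro: order_trans[OF norm_ge_zero])
      show "norm (f z) \<le> C / (real n)\<^sup>2" if "z \<in> path_image ?arc" for z
        using bound[of z] arc that n by auto
    qed (use n in auto)
    also have "\<dots> = C * pi * inverse (real n)"
      using n by (simp add: field_simps power2_eq_square)
    finally have "norm (contour_integral (linepath (- ?R) ?R) f) \<le> C * pi * inverse (real n)"
      using sum0 by (metis add_eq_0_iff norm_minus_cancel)
    also have "contour_integral (linepath (- ?R) ?R) f = integral {- real n..real n} (\<lambda>x. f (complex_of_real x))"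
      by (subst contour_integral_linepath_Reals_eq) (use n in auto)
    also have "\<dots> = I n"
      unfolding I_def using int
      by (subst set_borel_integral_eq_integral(2)[symmetric])
         (auto simp: set_lebesgue_integral_def set_integrable_def intro!: integrable_mult_indicator)
    finally show ?thesis .
  qed
  have "I \<longlonglongrightarrow> 0"
  proof (rule Lim_null_comparison)
    show "eventually (\<lambda>n. norm (I n) \<le> C * pi * inverse (real n)) sequentially"
      unfolding eventually_sequentially
      by (metis I_bound max.bounded_iff nat_ceiling_le_eq)
    show "(\<lambda>n. C * pi * inverse (real n)) \<longlonglongrightarrow> 0"
      by (intro tendsto_mult_right_zero lim_inverse_n)
  qed
  with lim show ?thesis by (rule LIMSEQ_unique)
qed

section \<open>Octonion algebra\<close>

lemma bounded_bilinear_omult: "bounded_bilinear (\<odot>)"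
proof -
  have "bilinear (\<odot>)"
    unfolding bilinear_def
    by (auto intro!: linearI simp: omult_def cross7_def prod_eq_iff vec_eq_iff inner_add algebra_simps)
  then show ?thesis
    by (simp add: bilinear_conv_bounded_bilinear)
qed

interpretation omult: bounded_bilinear "(\<odot>)"
  by (rule bounded_bilinear_omult)

text \<open>Polarisation of the multiplicativity of the norm.\<close>

lemma inner_omult_omult_left: "inner (p \<odot> q) (p \<odot> r) = (norm p)\<^sup>2 * inner q r"
proof -
  have "(norm (p \<odot> (q + r)))\<^sup>2 = (norm p)\<^sup>2 * (norm (q + r))\<^sup>2"
    by (simp add: norm_omult power_mult_distrib)
  moreover have "(norm (p \<odot> q))\<^sup>2 = (norm p)\<^sup>2 * (norm q)\<^sup>2" "(norm (p \<odot> r))\<^sup>2 = (norm p)\<^sup>2 * (norm r)\<^sup>2"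
    by (simp_all add: norm_omult power_mult_distrib)
  ultimately show ?thesis
    unfolding omult.add_right power2_norm_eq_inner by (simp add: inner_add inner_commute algebra_simps)
qed

lemma inner_omult_omult_right: "inner (q \<odot> p) (r \<odot> p) = (norm p)\<^sup>2 * inner q r"
proof -
  have "(norm ((q + r) \<odot> p))\<^sup>2 = (norm p)\<^sup>2 * (norm (q + r))\<^sup>2"
    by (simp add: norm_omult power_mult_distrib)
  moreover have "(norm (q \<odot> p))\<^sup>2 = (norm p)\<^sup>2 * (norm q)\<^sup>2" "(norm (r \<odot> p))\<^sup>2 = (norm p)\<^sup>2 * (norm r)\<^sup>2"
    by (simp_all add: norm_omult power_mult_distrib)
  ultimately show ?thesis
    unfolding omult.add_left power2_norm_eq_inner by (simp add: inner_add inner_commute algebra_simps)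
qed

lemma norm_ocnj [simp]: "norm (ocnj p) = norm p"
  by (simp add: ocnj_def norm_prod_def)

lemma inner_omult_adjoint_left: "inner (p \<odot> q) r = inner q (ocnj p \<odot> r)"
  by (simp add: omult_def cross7_def ocnj_def inner_prod_def inner_vec_def sum_7 numeral_mod_7 algebra_simps)

lemma inner_omult_adjoint_right: "inner (p \<odot> q) r = inner p (r \<odot> ocnj q)"
  by (simp add: omult_def cross7_def ocnj_def inner_prod_def inner_vec_def sum_7 numeral_mod_7 algebra_simps)

text \<open>A form of alternativity, used in place of the missing associativity. Against a test
  vector \<open>q\<close>, the adjoint rule turns the left side into an inner product of two
  products with the common left factor \<open>ocnj p\<close>, and polarisation evaluates it.\<close>

lemma omult_ocnj_cancel_left: "p \<odot> (ocnj p \<odot> c) = (norm p)\<^sup>2 *\<^sub>R c"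
proof -
  have "inner (p \<odot> (ocnj p \<odot> c)) q = inner ((norm p)\<^sup>2 *\<^sub>R c) q" for q
    by (simp only: inner_omult_adjoint_left[of p] inner_omult_omult_left norm_ocnj inner_scaleR_left)
  then show ?thesis
    by (metis vector_eq_rdot)
qed

lemma omult_ocnj_cancel_right: "(c \<odot> ocnj p) \<odot> p = (norm p)\<^sup>2 *\<^sub>R c"
proof -
  have "inner ((c \<odot> ocnj p) \<odot> p) q = inner ((norm p)\<^sup>2 *\<^sub>R c) q" for q
    by (simp only: inner_omult_adjoint_right[of _ p] inner_omult_omult_right norm_ocnj inner_scaleR_left)
  then show ?thesis
    by (metis vector_eq_rdot)
qed

lemma inner_imaginary_omult_skew:
  assumes "fst x = 0"
  shows "inner (x \<odot> p) q = - inner p (x \<odot> q)"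
proof -
  have "ocnj x = - x" using assms by (simp add: ocnj_def prod_eq_iff)
  then show ?thesis by (simp add: inner_omult_adjoint_left omult.minus_left)
qed

text \<open>Linearisation of z (z p) = -|z|^2 p at z = x + y: orthogonality cancels the square terms
  and leaves the mixed ones.\<close>

lemma imaginary_omult_anticommute:
  assumes "fst x = 0" "fst y = 0" "inner x y = 0"
  shows "x \<odot> (y \<odot> p) = - (y \<odot> (x \<odot> p))"
proof -
  have *: "z \<odot> (z \<odot> p) = - (norm z)\<^sup>2 *\<^sub>R p" if "fst z = 0" for z
  proof -
    have "ocnj z = - z" using that by (simp add: ocnj_def prod_eq_iff)
    then show ?thesis using omult_ocnj_cancel_left[of z p]
      by (simp add: omult.minus_left omult.minus_right) (metis minus_minus)
  qed
  have "(norm (x + y))\<^sup>2 = (norm x)\<^sup>2 + (norm y)\<^sup>2"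
    using assms unfolding power2_norm_eq_inner by (simp add: inner_add inner_commute)
  then have "(x + y) \<odot> ((x + y) \<odot> p) = x \<odot> (x \<odot> p) + y \<odot> (y \<odot> p)"
    using assms by (simp add: * algebra_simps)
  then show ?thesis
    by (simp add: omult.add_left omult.add_right add_eq_0_iff2)
qed

text \<open>The real part of \<open>a \<odot> ocnj b\<close> is \<open>inner a b\<close>, so
  orthogonality makes the quotient imaginary. The two products follow from the cancellation laws,
  the second by applying the unit once more to \<open>(0, w) \<odot> b = a\<close>.\<close>

lemma imaginary_unit_between:
  assumes a: "norm a = 1" and b: "norm b = 1" and ab: "inner a b = 0"
  obtains w where "norm w = 1" "(0, w) \<odot> b = a" "(0, w) \<odot> a = - b"
proof -
  define w where "w = snd (a \<odot> ocnj b)"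
  have w: "a \<odot> ocnj b = (0, w)"
    using ab by (simp add: w_def prod_eq_iff inner_octonion)
  have 1: "(0, w) \<odot> b = a"
    using omult_ocnj_cancel_right[of a b] b by (simp flip: w)
  have n: "norm (0 :: real, w) = 1"
    unfolding w[symmetric] using a b by (simp add: norm_omult)
  have "ocnj (0, w) = - (0, w)"
    by (simp add: ocnj_def)
  then have "(0, w) \<odot> a = - b"
    using omult_ocnj_cancel_left[of "(0, w)" b] n 1
    by (metis minus_minus mult_1 omult.minus_left omult.minus_right one_power2 scaleR_one)
  with n 1 show thesis by (intro that[of w]) (simp_all add: norm_prod_def)
qed

lemma subspace_orthonormal_pair_or_line:
  fixes S :: "'a::euclidean_space set"
  assumes S: "subspace S"
  obtains (pair) a b where "a \<in> S" "b \<in> S" "norm a = 1" "norm b = 1" "inner a b = 0"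
  | (line) b where "norm b = 1" "S \<subseteq> span {b}"
proof -
  obtain B where B: "B \<subseteq> S" "pairwise orthogonal B" "\<And>x. x \<in> B \<Longrightarrow> norm x = 1"
      "independent B" "card B = dim S" "span B = S"
    using orthonormal_basis_subspace[OF S] by metis
  show thesis
  proof (cases "\<exists>a\<in>B. \<exists>b\<in>B. a \<noteq> b")
    case True
    then obtain a b where "a \<in> B" "b \<in> B" "a \<noteq> b" by blast
    then show thesis using B by (intro pair[of a b]) (auto simp: pairwise_def orthogonal_def)
  next
    case False
    then have "B = {} \<or> (\<exists>b. B = {b})" by blast
    then show thesis
    proof
      \<comment> \<open>The zero subspace counts as part of an arbitrary line.\<close>
      assume "B = {}"
      obtain b :: 'a where "b \<in> Basis" using nonempty_Basis by blast
      then show thesis using \<open>B = {}\<close> B by (intro line[of b]) (auto simp: span_zero)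
    next
      assume "\<exists>b. B = {b}"
      then show thesis using B by (auto intro: line)
    qed
  qed
qed

section \<open>The Cauchy kernel and the case of a line\<close>

lemma oone_omult [simp]: "oone \<odot> p = p"
  by (simp add: omult_def oone_def cross7_def prod_eq_iff vec_eq_iff)

lemma ocnj_oone [simp]: "ocnj oone = oone"
  by (simp add: oone_def ocnj_def)

lemma inner_oone_right [simp]: "inner p oone = fst p"
  by (simp add: oone_def inner_prod_def)

lemma bounded_linear_ocnj: "bounded_linear ocnj"
  unfolding ocnj_def
  by (intro bounded_linear_Pair bounded_linear_minus bounded_linear_fst bounded_linear_snd)

lemma inner_ounit_right [simp]: "inner p (ounit j) = snd p $ j"
  by (simp add: ounit_def inner_prod_def inner_axis)

lemma octonion_expansion: "p = inner p oone *\<^sub>R oone + (\<Sum>j\<in>UNIV. inner p (ounit j) *\<^sub>R ounit j)"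
  unfolding inner_oone_right inner_ounit_right
  by (simp add: oone_def ounit_def prod_eq_iff fst_sum snd_sum vec_eq_iff sum_7 forall_7 axis_def)

lemma ounit_omult_ocnj_cancel: "ounit j \<odot> (ocnj (ounit j) \<odot> c) = c"
  by (simp add: omult_ocnj_cancel_left ounit_def norm_prod_def)

definition cauchy_kernel :: "octonion \<Rightarrow> octonion" where
  "cauchy_kernel z = (1 / norm z ^ 8) *\<^sub>R ocnj z"

lemma norm_cauchy_kernel: "norm (cauchy_kernel z) = 1 / norm z ^ 7"
  by (simp add: cauchy_kernel_def power_eq_if)

lemma norm_eq_inner_power4: "norm z ^ 8 = inner z z ^ 4" for z :: octonion
proof -
  have "norm z ^ 8 = ((norm z)\<^sup>2) ^ 4" by (simp flip: power_mult)
  then show ?thesis by (simp add: power2_norm_eq_inner)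
qed

text \<open>The pole is moved to -1, outside the half-space. Write w = z + 1 and N = |w|^2.
  Differentiating the conjugate gives \<open>c\<close> in each of the eight directions, since e_j
  times (conj e_j times c) is c; differentiating N^(-4) gives -8 N^(-5) w (conj w c) = -8 N^(-4) c.
  The sum is 0. Alternativity permits the constant right factor \<open>c\<close>.\<close>

lemma oct_analytic_cauchy_kernel_shift: "oct_analytic (\<lambda>z. cauchy_kernel (z + oone) \<odot> c)"
proof -
  let ?F = "\<lambda>z. cauchy_kernel (z + oone) \<odot> c"
  define N where "N = (\<lambda>z::octonion. inner (z + oone) (z + oone))"
  define D where "D = (\<lambda>z h. (1 / N z ^ 4) *\<^sub>R (ocnj h \<odot> c)
    - (8 * inner (z + oone) h / N z ^ 5) *\<^sub>R (ocnj (z + oone) \<odot> c))"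
  have N_pos: "N z > 0" if "z \<in> upper_half" for z
  proof -
    have "fst (z + oone) > 0" using that by (simp add: upper_half_def oone_def)
    then have "z + oone \<noteq> 0" by (metis fst_zero less_irrefl)
    then show ?thesis by (simp add: N_def)
  qed
  have F_eq: "?F = (\<lambda>z. (1 / N z ^ 4) *\<^sub>R (ocnj (z + oone) \<odot> c))"
    by (simp add: cauchy_kernel_def N_def norm_eq_inner_power4 omult.scaleR_left)
  have bl: "bounded_linear (\<lambda>h. ocnj h \<odot> c)"
    by (rule bounded_linear_compose[OF omult.bounded_linear_left bounded_linear_ocnj])
  have D_bl: "bounded_linear (D z)" for z
    unfolding D_def
    unfolding linear_conv_bounded_linear[symmetric]
    by (intro linearI) (simp_all add: linear_simps[OF bl] inner_add_right add_divide_distrib algebra_simps)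
  have deriv: "(?F has_derivative D z) (at z)" if z: "z \<in> upper_half" for z
  proof -
    have 1: "((\<lambda>z. ocnj (z + oone) \<odot> c) has_derivative (\<lambda>h. ocnj h \<odot> c)) (at z)"
      by (rule bounded_linear.has_derivative[OF bl]) (auto intro!: derivative_eq_intros)
    have 2: "((\<lambda>z. 1 / N z ^ 4) has_derivative (\<lambda>h. - (8 * inner (z + oone) h / N z ^ 5))) (at z)"
    proof -
      have "(N has_derivative (\<lambda>h. 2 * inner (z + oone) h)) (at z)"
        unfolding N_def by (auto intro!: derivative_eq_intros simp: inner_commute)
      moreover have "((\<lambda>n::real. 1 / n ^ 4) has_real_derivative - (4 / N z ^ 5)) (at (N z))"
        using N_pos[OF z] by (auto intro!: derivative_eq_intros simp: field_simps eval_nat_numeral)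
      ultimately have "((\<lambda>z. 1 / N z ^ 4) has_derivative (\<lambda>h. (2 * inner (z + oone) h) * - (4 / N z ^ 5))) (at z)"
        by (rule DERIV_compose_FDERIV[rotated])
      then show ?thesis by (simp add: mult_ac)
    qed
    have "((\<lambda>z. (1 / N z ^ 4) *\<^sub>R (ocnj (z + oone) \<odot> c)) has_derivative
        (\<lambda>h. (1 / N z ^ 4) *\<^sub>R (ocnj h \<odot> c) + (- (8 * inner (z + oone) h / N z ^ 5)) *\<^sub>R (ocnj (z + oone) \<odot> c))) (at z)"
      by (rule has_derivative_scaleR[OF 2 1])
    then show ?thesis unfolding F_eq D_def by simp
  qed
  have C1: "C1_on upper_half ?F"
    unfolding C1_on_def
  proof (intro exI conjI ballI)
    show "(?F has_derivative blinfun_apply (Blinfun (D z))) (at z)" if "z \<in> upper_half" for z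
      using deriv[OF that] by (simp add: bounded_linear_Blinfun_apply[OF D_bl])
    show "continuous_on upper_half (\<lambda>z. Blinfun (D z))"
    proof (rule continuous_on_blinfun_componentwise)
      fix i :: octonion
      have c1: "continuous_on upper_half (\<lambda>z. ocnj (z + oone) \<odot> c)"
        by (intro bounded_linear.continuous_on[OF bl] continuous_intros)
      have c2: "continuous_on upper_half N"
        unfolding N_def by (intro continuous_intros)
      show "continuous_on upper_half (\<lambda>z. Blinfun (D z) i)"
        unfolding bounded_linear_Blinfun_apply[OF D_bl] unfolding D_def
        by (intro continuous_intros c1 c2) (auto dest!: N_pos)
    qed
  qed
  have "dirac ?F z = 0" if z: "z \<in> upper_half" for z
  proof -
    have fd: "frechet_derivative ?F (at z) = D z"
      using frechet_derivative_at[OF deriv[OF z]] by simp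
    let ?w = "z + oone"
    define q where "q = ocnj ?w \<odot> c"
    have one: "D z oone = (1 / N z ^ 4) *\<^sub>R c - (8 / N z ^ 5) *\<^sub>R ((inner ?w oone *\<^sub>R oone) \<odot> q)"
      by (simp add: D_def q_def omult.scaleR_left)
    have unit: "ounit j \<odot> D z (ounit j) = (1 / N z ^ 4) *\<^sub>R c
        - (8 / N z ^ 5) *\<^sub>R ((inner ?w (ounit j) *\<^sub>R ounit j) \<odot> q)" for j
      by (simp add: D_def q_def omult.diff_right omult.scaleR_right omult.scaleR_left ounit_omult_ocnj_cancel)
    have "dirac ?F z = (8 / N z ^ 4) *\<^sub>R c - (8 / N z ^ 5) *\<^sub>R
        ((inner ?w oone *\<^sub>R oone + (\<Sum>j\<in>UNIV. inner ?w (ounit j) *\<^sub>R ounit j)) \<odot> q)"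
      unfolding dirac_def fd one unit
      by (simp add: sum_subtractf omult.add_left omult.sum_left scaleR_add_right scaleR_sum_right
          sum_constant_scaleR flip: scaleR_add_left del: inner_oone_right inner_ounit_right)
    also have "\<dots> = (8 / N z ^ 4) *\<^sub>R c - (8 / N z ^ 5) *\<^sub>R (?w \<odot> q)"
      by (simp only: octonion_expansion[symmetric])
    also have "?w \<odot> q = N z *\<^sub>R c"
      by (simp add: q_def omult_ocnj_cancel_left N_def power2_norm_eq_inner)
    finally show ?thesis
      using N_pos[OF z] by (simp add: field_simps eval_nat_numeral)
  qed
  with C1 show ?thesis by (simp add: oct_analytic_def)
qed

lemma norm_pair_square: "(norm (t, x))\<^sup>2 = t\<^sup>2 + (norm x)\<^sup>2" for t :: real
  by (simp add: norm_prod_def)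

text \<open>The squared norm is |c|^2 / ((t + 1)^2 + |x|^2)^7, which decreases in \<open>t\<close>,
  so the integral at height 0 bounds all others.\<close>

lemma cauchy_kernel_shift_in_Hp: "(\<lambda>z. cauchy_kernel (z + oone) \<odot> c) \<in> Hp_space 2"
proof -
  let ?F = "\<lambda>z. cauchy_kernel (z + oone) \<odot> c"
  let ?g = "\<lambda>t (x :: real ^ 7). (norm c)\<^sup>2 * (1 / ((t + 1)\<^sup>2 + (norm x)\<^sup>2) ^ 7)"
  have eq: "norm (?F (t, x)) powr 2 = ?g t x" for t x
  proof -
    have "norm ((t, x) + oone) ^ 14 = ((t + 1)\<^sup>2 + (norm x)\<^sup>2) ^ 7"
    proof -
      have "norm ((t, x) + oone) ^ 14 = ((norm (t + 1, x))\<^sup>2) ^ 7"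
        by (simp add: oone_def flip: power_mult)
      then show ?thesis by (simp add: norm_pair_square)
    qed
    then show ?thesis
      by (simp add: norm_omult norm_cauchy_kernel power_mult_distrib power_divide flip: power_mult)
  qed
  have int: "integrable lborel (?g t)" if "t > 0" for t
    using that by (intro integrable_mult_right integrable_japanese_bracket) auto
  have meas: "?g t \<in> borel_measurable borel" for t
    by measurable
  have bound: "Lp_norm 2 (\<lambda>x. ?F (t, x)) \<le> (LINT x|lborel. ?g 0 x) powr (1 / 2)" if t: "t > 0" for t
  proof -
    have "(LINT x|lebesgue. ?g t x) = (LINT x|lborel. ?g t x)"
      by (rule integral_completion) measurable
    also have "\<dots> \<le> (LINT x|lborel. ?g 0 x)"
    proof (rule integral_mono)
      show "integrable lborel (?g 0)"
        using integrable_mult_right[OF integrable_japanese_bracket[of 1 7, where 'a = "real ^ 7"], of "(norm c)\<^sup>2"] by simp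
      show "?g t x \<le> ?g 0 x" for x
        using t by (intro mult_left_mono divide_left_mono power_mono) (auto simp: add_pos_nonneg intro!: mult_pos_pos zero_less_power)
    qed (rule int[OF t])
    finally show ?thesis
      unfolding Lp_norm_def eq by (intro powr_mono2) (auto intro!: integral_nonneg)
  qed
  show ?thesis
    unfolding Hp_space_def mem_Collect_eq
  proof (intro conjI allI impI oct_analytic_cauchy_kernel_shift)
    show "integrable lebesgue (\<lambda>x. norm (?F (t, x)) powr 2)" if "t > 0" for t
      unfolding eq using int[OF that] meas[of t] by (simp add: integrable_completion)
    show "bdd_above ((\<lambda>t. Lp_norm 2 (\<lambda>x. ?F (t, x))) ` {0<..})"
      using bound by (intro bdd_aboveI2) simp
  qed
qed

text \<open>The form \<open>(x, y) \<mapsto> inner (x \<odot> c) (y \<odot> b)\<close> is antisymmetric on the plane spanned by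
  \<open>v1\<close> and \<open>v2\<close>, so that the kernel times \<open>c\<close>, paired with right multiples of \<open>b\<close>, has nonzero
  circulation there.\<close>

lemma obtain_rotation_plane:
  assumes b: "norm b = 1"
  obtains c :: octonion and v1 v2 :: "real ^ 7" where
    "norm v1 = 1" "norm v2 = 1" "inner v1 v2 = 0"
    "\<And>x. x \<in> {(0, v1), (0, v2)} \<Longrightarrow> inner c (x \<odot> b) = 0"
    "\<And>x. x \<in> {(0, v1), (0, v2)} \<Longrightarrow> inner (x \<odot> c) (x \<odot> b) = 0"
    "inner ((0, v1) \<odot> c) ((0, v2) \<odot> b) = 1" "inner ((0, v2) \<odot> c) ((0, v1) \<odot> b) = -1"
proof -
  \<comment> \<open>\<open>e2\<close> is built so that \<open>e2 \<odot> b = e1 \<odot> c\<close>,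
    which forces the first mixed pairing to be 1. Taking \<open>c = e \<odot> b\<close> with
    \<open>e\<close> orthogonal to 1 and \<open>e1\<close> makes \<open>c\<close> orthogonal to
    \<open>b\<close> and to \<open>e1 \<odot> b\<close>.\<close>
  define e where "e = ounit 1"
  define e1 where "e1 = ounit 2"
  define c where "c = e \<odot> b"
  define e2 where "e2 = (e1 \<odot> c) \<odot> ocnj b"
  have e: "norm e = 1" "norm e1 = 1" "fst e = 0" "fst e1 = 0" "inner e e1 = 0"
    by (simp_all add: e_def e1_def ounit_def norm_prod_def inner_axis_axis)
  have c: "norm c = 1" using b e by (simp add: c_def norm_omult)
  have bb: "inner (p \<odot> b) (q \<odot> b) = inner p q" for p q
    using b by (simp add: inner_omult_omult_right)
  have e2b: "e2 \<odot> b = e1 \<odot> c"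
    using b by (simp add: e2_def omult_ocnj_cancel_right)
  have cb: "inner c b = 0"
    using bb[of e oone] e by (simp add: c_def)
  have n2: "norm e2 = 1"
    using e c b by (simp add: e2_def norm_omult)
  have f2: "fst e2 = 0"
  proof -
    have "fst e2 = inner (e1 \<odot> c) b"
      using bb[of e2 oone] by (simp add: e2b)
    also have "\<dots> = - inner c (e1 \<odot> b)"
      using e by (intro inner_imaginary_omult_skew)
    also have "\<dots> = 0"
      using bb[of e e1] e by (simp add: c_def)
    finally show ?thesis .
  qed
  have self: "inner (x \<odot> p) p = 0" if "fst x = 0" for x p
    using inner_imaginary_omult_skew[OF that, of p p] by (simp add: inner_commute)
  have e1e2: "inner e1 e2 = 0"
    using bb[of e1 e2] inner_omult_omult_left[of e1 b c] cb by (simp add: e2b inner_commute)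
  have e2e: "inner c (e2 \<odot> b) = 0"
    using self[of e1 c] e by (simp add: e2b inner_commute)
  have e1e: "inner c (e1 \<odot> b) = 0"
    using bb[of e e1] e by (simp add: c_def)
  have pair: "(0, snd e1) = e1" "(0, snd e2) = e2"
    using e f2 by (simp_all add: prod_eq_iff)
  show thesis
  proof (rule that[of "snd e1" "snd e2" c])
    show "norm (snd e1) = 1" "norm (snd e2) = 1"
      using e n2 f2 by (simp_all add: norm_prod_def)
    show "inner (snd e1) (snd e2) = 0"
      using e1e2 f2 by (simp add: inner_prod_def)
    show "inner c (x \<odot> b) = 0" if "x \<in> {(0, snd e1), (0, snd e2)}" for x
      using that e1e e2e unfolding pair by auto
    show "inner (x \<odot> c) (x \<odot> b) = 0" if "x \<in> {(0, snd e1), (0, snd e2)}" for x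
      using cb by (simp add: inner_omult_omult_left)
    show "inner ((0, snd e1) \<odot> c) ((0, snd e2) \<odot> b) = 1"
      unfolding pair e2b using c e by (simp add: norm_omult flip: power2_norm_eq_inner)
    \<comment> \<open>Three sign changes: \<open>e2\<close> moves to the other side, the two
      imaginary units are interchanged, and \<open>e1\<close> moves back.\<close>
    have "inner (e2 \<odot> c) (e1 \<odot> b) = - inner c (e2 \<odot> (e1 \<odot> b))"
      using f2 by (rule inner_imaginary_omult_skew)
    also have "e2 \<odot> (e1 \<odot> b) = - (e1 \<odot> (e2 \<odot> b))"
      using imaginary_omult_anticommute[OF f2 e(4), of b] e1e2 by (simp add: inner_commute)
    also have "- inner c (- (e1 \<odot> (e2 \<odot> b))) = - inner (e1 \<odot> c) (e2 \<odot> b)"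
      using inner_imaginary_omult_skew[OF e(4), of c "e2 \<odot> b"] by simp
    also have "\<dots> = -1"
      using c e by (simp add: e2b norm_omult flip: power2_norm_eq_inner)
    finally show "inner ((0, snd e2) \<odot> c) ((0, snd e1) \<odot> b) = -1"
      unfolding pair .
  qed
qed

text \<open>\<open>k \<theta> u\<close> is the derivative in \<open>\<theta>\<close> of
  \<open>1 / (6 * (1 + (norm (X \<theta> - u))\<^sup>2) ^ 3)\<close>, so its integral over a full
  turn vanishes for each \<open>u\<close>; Fubini carries this over to the superposition with
  density \<open>\<phi>\<close>. It is the tangential component of the Cauchy kernel at height
  1.\<close>

lemma circle_circulation_eq_0:
  fixes v1 v2 :: "real ^ 7" and \<phi> :: "real ^ 7 \<Rightarrow> real"
  assumes v: "norm v1 = 1" "norm v2 = 1" "inner v1 v2 = 0"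
    and \<phi> [measurable]: "\<phi> \<in> borel_measurable borel" and sq: "integrable lborel (\<lambda>u. (\<phi> u)\<^sup>2)"
  defines "X \<equiv> \<lambda>\<theta>. cos \<theta> *\<^sub>R v1 + sin \<theta> *\<^sub>R v2" and "X' \<equiv> \<lambda>\<theta>. cos \<theta> *\<^sub>R v2 - sin \<theta> *\<^sub>R v1"
  defines "k \<equiv> \<lambda>\<theta> u. - inner (X \<theta> - u) (X' \<theta>) / (1 + (norm (X \<theta> - u))\<^sup>2) ^ 4"
  shows "(LINT \<theta>|lborel. indicator {0..2 * pi} \<theta> * (LINT u|lborel. \<phi> u * k \<theta> u)) = 0"
proof -
  define f where "f = (\<lambda>\<theta> u. indicator {0..2 * pi} \<theta> * (\<phi> u * k \<theta> u))"
  have norm_X: "norm (X \<theta>) = 1" and norm_X': "norm (X' \<theta>) = 1" for \<theta>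
    using v unfolding X_def X'_def norm_eq_1
    by (simp_all add: inner_add inner_diff inner_commute flip: power2_eq_square)
  have X_meas [measurable]: "X \<in> borel_measurable borel" "X' \<in> borel_measurable borel"
    unfolding X_def X'_def by measurable
  \<comment> \<open>A bound free of \<open>\<theta>\<close>, for domination. Since the circle has
    radius 1, 1 + |u|^2 <= 3 (1 + r^2), and 27 is 3^3.\<close>
  have k_bound: "\<bar>k \<theta> u\<bar> \<le> 27 / (1 + (norm u)\<^sup>2) ^ 3" for \<theta> u
  proof -
    define r where "r = norm (X \<theta> - u)"
    have r: "r \<ge> 0" by (simp add: r_def)
    have "\<bar>inner (X \<theta> - u) (X' \<theta>)\<bar> \<le> r"
      using Cauchy_Schwarz_ineq2[of "X \<theta> - u" "X' \<theta>"] by (simp add: norm_X' r_def)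
    also have "r \<le> 1 + r\<^sup>2"
      using zero_le_power2[of "r - 1"] r by (simp add: power2_eq_square algebra_simps)
    finally have "\<bar>k \<theta> u\<bar> \<le> (1 + r\<^sup>2) / (1 + r\<^sup>2) ^ 4"
      unfolding k_def r_def by (simp add: abs_divide divide_right_mono)
    also have "\<dots> = 1 / (1 + r\<^sup>2) ^ 3"
    proof -
      have "q / q ^ 4 = 1 / q ^ 3" for q :: real by (simp add: eval_nat_numeral)
      then show ?thesis .
    qed
    also have "\<dots> \<le> 27 / (1 + (norm u)\<^sup>2) ^ 3"
    proof -
      have "norm u \<le> r + 1"
        using norm_triangle_ineq4[of "X \<theta>" "X \<theta> - u"] by (simp add: norm_X r_def)
      then have "(norm u)\<^sup>2 \<le> (r + 1)\<^sup>2" by (intro power_mono) auto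
      also have "\<dots> \<le> 2 + 2 * r\<^sup>2"
        using zero_le_power2[of "r - 1"] by (simp add: power2_eq_square algebra_simps)
      also have "\<dots> \<le> 2 + 3 * r\<^sup>2" by simp
      finally have "1 + (norm u)\<^sup>2 \<le> 3 * (1 + r\<^sup>2)" by (simp add: algebra_simps)
      then have "(1 + (norm u)\<^sup>2) ^ 3 \<le> (3 * (1 + r\<^sup>2)) ^ 3"
        by (intro power_mono) auto
      then have "(1 + (norm u)\<^sup>2) ^ 3 \<le> 27 * (1 + r\<^sup>2) ^ 3"
        by (simp only: power_mult_distrib) simp
      moreover have "(1 + r\<^sup>2) ^ 3 > 0" "(1 + (norm u)\<^sup>2) ^ 3 > 0"
        by (auto intro!: zero_less_power add_pos_nonneg)
      ultimately show ?thesis by (simp add: divide_simps)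
    qed
    finally show ?thesis .
  qed
  \<comment> \<open>Twice a product is at most the sum of the squares; this produces an integrable
    majorant from square integrability of \<open>\<phi>\<close>.\<close>
  define G where "G = (\<lambda>u. 27 * ((\<phi> u)\<^sup>2 + 1 / (1 + (norm u)\<^sup>2) ^ 6))"
  have G_nonneg: "G u \<ge> 0" for u by (simp add: G_def)
  have G_int: "integrable lborel G"
    unfolding G_def using integrable_japanese_bracket[of 1 6, where 'a = "real ^ 7"] sq
    by (intro integrable_mult_right Bochner_Integration.integrable_add) auto
  then have G_meas [measurable]: "G \<in> borel_measurable borel" by auto
  have f_bound: "\<bar>f \<theta> u\<bar> \<le> indicator {0..2 * pi} \<theta> * G u" for \<theta> u
  proof -
    have "\<bar>\<phi> u * k \<theta> u\<bar> \<le> \<bar>\<phi> u\<bar> * (27 / (1 + (norm u)\<^sup>2) ^ 3)"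
      unfolding abs_mult by (intro mult_left_mono k_bound) simp
    also have "\<dots> \<le> 27 * (\<bar>\<phi> u\<bar>\<^sup>2 + (1 / (1 + (norm u)\<^sup>2) ^ 3)\<^sup>2)"
    proof -
      have *: "x * (27 / y) \<le> 27 * (x\<^sup>2 + (1 / y)\<^sup>2)" if "x \<ge> 0" for x y :: real
      proof -
        have "x * (27 / y) = 27 / 2 * (2 * x * (1 / y))" by simp
        also have "\<dots> \<le> 27 / 2 * (x\<^sup>2 + (1 / y)\<^sup>2)"
          by (intro mult_left_mono sum_squares_bound) simp
        also have "\<dots> \<le> 27 * (x\<^sup>2 + (1 / y)\<^sup>2)"
          by (intro mult_right_mono) simp_all
        finally show ?thesis .
      qed
      show ?thesis by (rule *) simp
    qed
    also have "\<dots> = G u"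
      by (simp add: G_def power_divide flip: power_mult)
    finally show ?thesis
      by (simp add: f_def abs_mult indicator_def)
  qed
  have f_meas [measurable]: "case_prod f \<in> borel_measurable (lborel \<Otimes>\<^sub>M lborel)"
    unfolding f_def k_def by measurable
  have "integrable (lborel \<Otimes>\<^sub>M lborel) (\<lambda>(\<theta>, u). indicator {0..2 * pi} \<theta> * G u)"
  proof (rule lborel_pair.Fubini_integrable)
    have "(\<lambda>\<theta>. LINT u|lborel. norm (case (\<theta>, u) of (\<theta>, u) \<Rightarrow> indicator {0..2 * pi} \<theta> * G u))
        = (\<lambda>\<theta>::real. indicator {0..2 * pi} \<theta> * (LINT u|lborel. G u))"
      using G_nonneg by (simp add: abs_mult indicator_def)
    then show "integrable lborel (\<lambda>\<theta>. LINT u|lborel. norm (case (\<theta>, u) of (\<theta>, u) \<Rightarrow> indicator {0..2 * pi} \<theta> * G u))"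
      by (auto intro!: integrable_mult_left)
    show "AE \<theta> in lborel. integrable lborel (\<lambda>u. case (\<theta>, u) of (\<theta>, u) \<Rightarrow> indicator {0..2 * pi} \<theta> * G u)"
      using G_int by auto
  qed measurable
  then have f_int: "integrable (lborel \<Otimes>\<^sub>M lborel) (case_prod f)"
    by (rule Bochner_Integration.integrable_bound) (use f_bound G_nonneg in \<open>auto simp: abs_mult\<close>)
  have inner0: "(LINT \<theta>|lborel. f \<theta> u) = 0" for u
  proof -
    define F where "F = (\<lambda>\<theta>. \<phi> u / 6 * (1 / (1 + inner (X \<theta> - u) (X \<theta> - u)) ^ 3))"
    have pos: "1 + inner (X \<theta> - u) (X \<theta> - u) > 0" for \<theta>
      by (simp add: add_pos_nonneg)
    have dX: "(X has_vector_derivative X' \<theta>) (at \<theta>)" for \<theta>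
      unfolding X_def X'_def by (auto intro!: derivative_eq_intros simp: algebra_simps)
    have dN: "((\<lambda>\<theta>. 1 + inner (X \<theta> - u) (X \<theta> - u)) has_real_derivative 2 * inner (X \<theta> - u) (X' \<theta>)) (at \<theta>)" for \<theta>
    proof -
      have "((\<lambda>\<theta>. X \<theta> - u) has_derivative (\<lambda>h. h *\<^sub>R X' \<theta>)) (at \<theta>)"
        using dX[of \<theta>] unfolding has_vector_derivative_def by (auto intro!: derivative_eq_intros)
      from has_derivative_add[OF has_derivative_const[of 1] has_derivative_inner[OF this this]]
      have "((\<lambda>\<theta>. 1 + inner (X \<theta> - u) (X \<theta> - u)) has_derivative
        (\<lambda>h. inner (X \<theta> - u) (h *\<^sub>R X' \<theta>) + inner (h *\<^sub>R X' \<theta>) (X \<theta> - u))) (at \<theta>)"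
        by simp
      moreover have "(\<lambda>h. inner (X \<theta> - u) (h *\<^sub>R X' \<theta>) + inner (h *\<^sub>R X' \<theta>) (X \<theta> - u))
          = (*) (2 * inner (X \<theta> - u) (X' \<theta>))"
        by (simp add: fun_eq_iff inner_commute)
      ultimately show ?thesis
        unfolding has_field_derivative_def by simp
    qed
    have dF: "(F has_real_derivative \<phi> u * k \<theta> u) (at \<theta>)" for \<theta>
    proof -
      have "((\<lambda>y. \<phi> u / 6 * (1 / y ^ 3)) has_real_derivative - (\<phi> u / 2) / y ^ 4) (at y)" if "y > 0" for y
        using that by (auto intro!: derivative_eq_intros simp: divide_simps)
      from DERIV_chain2[OF this[OF pos] dN] show ?thesis
        unfolding F_def k_def power2_norm_eq_inner by simp
    qed
    have cont: "isCont (\<lambda>\<theta>. \<phi> u * k \<theta> u) \<theta>" for \<theta>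
      unfolding k_def X_def X'_def
      by (intro continuous_intros) (metis add_pos_nonneg less_irrefl power_not_zero zero_le_power2 zero_less_one)
    have "(LINT \<theta>|lborel. (\<phi> u * k \<theta> u) * indicator {0..2 * pi} \<theta>) = F (2 * pi) - F 0"
      by (rule integral_FTC_Icc_real) (use dF cont in auto)
    also have "\<dots> = 0"
      by (simp add: F_def X_def)
    finally show ?thesis
      by (simp add: f_def mult.commute)
  qed
  have "(LINT \<theta>|lborel. LINT u|lborel. f \<theta> u) = (LINT u|lborel. LINT \<theta>|lborel. f \<theta> u)"
    by (rule lborel_pair.Fubini_integral[OF f_int, symmetric])
  also have "\<dots> = 0" by (simp add: inner0)
  finally show ?thesis by (simp add: f_def)
qed

section \<open>Failure of surjectivity when the values lie on a line\<close>

lemma cauchy_integral_kernel: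
  "cauchy_integral f z = (1 / omega8) *\<^sub>R (LINT u|lebesgue. cauchy_kernel (z - (0, u)) \<odot> f u)"
  by (simp add: cauchy_integral_def cauchy_kernel_def norm_minus_commute)

text \<open>Right multiplication by the unit octonion \<open>b\<close> is an isometry. Pairing the
  Cauchy integral of \<open>\<phi> b\<close> with the tangent times \<open>b\<close> therefore gives
  the integral of \<open>\<phi>\<close> against the tangential kernel, which has zero circulation.
  For the shifted kernel the same pairing is a nonzero constant along the circle.\<close>

lemma cauchy_integral_not_onto_of_line:
  assumes b: "norm b = 1" and H: "H \<subseteq> span {b}"
  obtains F where "F \<in> Hp_space 2" "\<And>f. f \<in> Lp_space 2 H \<Longrightarrow> \<not> half_equal (cauchy_integral f) F"
proof -
  obtain c v1 v2 where v: "norm v1 = 1" "norm v2 = 1" "inner v1 v2 = 0"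
    and c1: "\<And>x. x \<in> {(0, v1), (0, v2)} \<Longrightarrow> inner c (x \<odot> b) = 0"
    and c2: "\<And>x. x \<in> {(0, v1), (0, v2)} \<Longrightarrow> inner (x \<odot> c) (x \<odot> b) = 0"
    and c3: "inner ((0, v1) \<odot> c) ((0, v2) \<odot> b) = 1" "inner ((0, v2) \<odot> c) ((0, v1) \<odot> b) = -1"
    using obtain_rotation_plane[OF b] by metis
  let ?F = "\<lambda>z. cauchy_kernel (z + oone) \<odot> c"
  define X where "X = (\<lambda>\<theta>. cos \<theta> *\<^sub>R v1 + sin \<theta> *\<^sub>R v2)"
  define X' where "X' = (\<lambda>\<theta>. cos \<theta> *\<^sub>R v2 - sin \<theta> *\<^sub>R v1)"
  define k where "k = (\<lambda>\<theta> u. - inner (X \<theta> - u) (X' \<theta>) / (1 + (norm (X \<theta> - u))\<^sup>2) ^ 4)"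
  have norm_X: "norm (X \<theta>) = 1" for \<theta>
    using v unfolding X_def norm_eq_1
    by (simp add: inner_add inner_commute flip: power2_eq_square)
  have F_circ: "inner (?F (1, X \<theta>)) ((0, X' \<theta>) \<odot> b) = - 1 / 625" for \<theta>
  proof -
    define x where "x = cos \<theta> *\<^sub>R (0 :: real, v1) + sin \<theta> *\<^sub>R (0, v2)"
    define x' where "x' = cos \<theta> *\<^sub>R (0 :: real, v2) - sin \<theta> *\<^sub>R (0, v1)"
    have x: "(0, X \<theta>) = x" "(0, X' \<theta>) = x'"
      by (simp_all add: x_def x'_def X_def X'_def)
    \<comment> \<open>On the unit circle at height 1 the shifted point has squared norm 2^2 + 1 = 5,
      so 625 = 5^4 is its eighth power norm.\<close>
    have "(norm ((1, X \<theta>) + oone))\<^sup>2 = 5"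
      by (simp add: oone_def norm_pair_square norm_X)
    then have "norm ((1, X \<theta>) + oone) ^ 8 = 625"
      using power_mult[of "norm ((1, X \<theta>) + oone)" 2 4] by simp
    moreover have "ocnj ((1, X \<theta>) + oone) = 2 *\<^sub>R oone - x"
      by (simp add: ocnj_def oone_def flip: x)
    ultimately have "?F (1, X \<theta>) = (1 / 625) *\<^sub>R (2 *\<^sub>R c - x \<odot> c)"
      by (simp add: cauchy_kernel_def omult.scaleR_left omult.diff_left)
    moreover have "inner c (x' \<odot> b) = 0"
      using c1[of "(0, v1)"] c1[of "(0, v2)"]
      unfolding x'_def omult.diff_left omult.scaleR_left inner_diff inner_scaleR_right by simp
    moreover have "inner (x \<odot> c) (x' \<odot> b) = 1"
      using c2[of "(0, v1)"] c2[of "(0, v2)"] c3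
      unfolding x_def x'_def omult.diff_left omult.add_left omult.scaleR_left inner_diff inner_add
        inner_scaleR_left inner_scaleR_right by (simp flip: power2_eq_square)
    ultimately show ?thesis
      by (simp add: x inner_diff)
  qed
  have "\<not> half_equal (cauchy_integral f) ?F" if f: "f \<in> Lp_space 2 H" for f
  proof
    assume eq: "half_equal (cauchy_integral f) ?F"
    have f_meas: "f \<in> borel_measurable lebesgue" and f_H: "AE u in lebesgue. f u \<in> H"
      and f_int: "integrable lebesgue (\<lambda>u. norm (f u) powr 2)"
      using f by (auto simp: Lp_space_def)
    have "(\<lambda>u. inner (f u) b) \<in> borel_measurable lebesgue"
      using f_meas by measurable
    \<comment> \<open>A Borel representative of the Lebesgue measurable coefficient, so that product
      measurability and Fubini are available.\<close>
    then obtain \<phi> where \<phi> [measurable]: "\<phi> \<in> borel_measurable borel"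
      and \<phi>_eq: "AE u in lborel. inner (f u) b = \<phi> u"
      using completion_ex_borel_measurable_real[of _ lborel] by auto
    have f_eq: "AE u in lebesgue. f u = \<phi> u *\<^sub>R b"
      using f_H AE_completion[OF \<phi>_eq]
    proof eventually_elim
      case (elim u)
      then obtain r where "f u = r *\<^sub>R b" using H by (auto simp: span_singleton)
      with elim b show ?case by (simp add: norm_eq_1)
    qed
    have "integrable lebesgue (\<lambda>u. (\<phi> u)\<^sup>2) \<longleftrightarrow> integrable lebesgue (\<lambda>u. norm (f u) powr 2)"
      using f_meas f_eq b by (intro integrable_cong_AE) (auto intro: measurable_completion)
    then have \<phi>_sq: "integrable lborel (\<lambda>u. (\<phi> u)\<^sup>2)"
      using f_int by (simp add: integrable_completion)
    have C: "(1 / omega8) * (LINT u|lborel. \<phi> u * k \<theta> u) = - 1 / 625" for \<theta>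
    proof -
      let ?z = "(1 :: real, X \<theta>)" and ?y = "(0, X' \<theta>) \<odot> b"
      let ?I = "\<lambda>u. cauchy_kernel (?z - (0, u)) \<odot> f u"
      have val: "(1 / omega8) * inner (LINT u|lebesgue. ?I u) ?y = - 1 / 625"
      proof -
        have "cauchy_integral f ?z = ?F ?z"
          using eq by (simp add: half_equal_def upper_half_def)
        then have "inner (cauchy_integral f ?z) ?y = - 1 / 625"
          using F_circ[of \<theta>] by simp
        then show ?thesis unfolding cauchy_integral_kernel inner_scaleR_left .
      qed
      \<comment> \<open>A non-integrable integrand would have integral 0 by convention, contrary to
        the nonzero value just found.\<close>
      have "integrable lebesgue ?I"
      proof (rule ccontr)
        assume "\<not> integrable lebesgue ?I"
        then have "(LINT u|lebesgue. ?I u) = 0" by (rule not_integrable_integral_eq)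
        with val show False by (simp only: inner_zero_left)
      qed
      then have "inner (LINT u|lebesgue. ?I u) ?y = (LINT u|lebesgue. inner (?I u) ?y)"
        by simp
      also have "\<dots> = (LINT u|lebesgue. \<phi> u * k \<theta> u)"
      proof (rule integral_cong_AE)
        show "(\<lambda>u. inner (?I u) ?y) \<in> borel_measurable lebesgue"
          using \<open>integrable lebesgue ?I\<close> by (auto dest: borel_measurable_integrable)
        have "(\<lambda>u. \<phi> u * k \<theta> u) \<in> borel_measurable borel"
          unfolding k_def by measurable
        then show "(\<lambda>u. \<phi> u * k \<theta> u) \<in> borel_measurable lebesgue"
          by (simp add: measurable_completion)
        show "AE u in lebesgue. inner (?I u) ?y = \<phi> u * k \<theta> u"
          using f_eq
        proof eventually_elim
          case (elim u)
          have "norm (?z - (0, u)) ^ 8 = (1 + (norm (X \<theta> - u))\<^sup>2) ^ 4"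
          proof -
            have "norm (?z - (0, u)) ^ 8 = ((norm (1 :: real, X \<theta> - u))\<^sup>2) ^ 4"
              by (simp flip: power_mult)
            then show ?thesis by (simp add: norm_pair_square)
          qed
          then have "inner (cauchy_kernel (?z - (0, u))) (0, X' \<theta>) = k \<theta> u"
            by (simp add: cauchy_kernel_def k_def ocnj_def inner_prod_def inner_diff_left minus_divide_left)
          then show ?case
            using b by (simp add: elim omult.scaleR_right inner_omult_omult_right)
        qed
      qed
      also have "\<dots> = (LINT u|lborel. \<phi> u * k \<theta> u)"
        by (rule integral_completion) (unfold k_def, measurable)
      finally show ?thesis using val by simp
    qed
    define c0 where "c0 = - omega8 / 625"
    \<comment> \<open>Since \<open>1 / 0 = 0\<close>, the nonzero value in \<open>C\<close> rules
      out \<open>omega8 = 0\<close> without computing the area of the sphere.\<close>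
    have w: "omega8 \<noteq> 0" using C[of 0] by auto
    have C': "(LINT u|lborel. \<phi> u * k \<theta> u) = c0" for \<theta>
      using C[of \<theta>] w by (simp add: c0_def field_simps)
    have "(LINT \<theta>|lborel. indicator {0..2 * pi} \<theta> * c0) = 0"
      using circle_circulation_eq_0[OF v \<phi> \<phi>_sq]
      unfolding C'[unfolded k_def X_def X'_def] .
    then have "2 * pi * c0 = 0"
      by (simp add: measure_lborel_Icc)
    then show False using w by (simp add: c0_def)
  qed
  then show thesis
    by (intro that[OF cauchy_kernel_shift_in_Hp])
qed

section \<open>The error caused by the cut-off\<close>

lemma integral_lborel_affine:
  fixes f :: "'a::euclidean_space \<Rightarrow> 'b::{banach, second_countable_topology}"
  assumes [measurable]: "f \<in> borel_measurable borel" and c: "c \<noteq> 0"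
  shows "(LINT x|lborel. f x) = \<bar>c\<bar> ^ DIM('a) *\<^sub>R (LINT x|lborel. f (t + c *\<^sub>R x))"
proof -
  have "(LINT x|lborel. f x) = (LINT x|density (distr lborel borel (\<lambda>x. t + c *\<^sub>R x)) (\<lambda>_. \<bar>c\<bar> ^ DIM('a)). f x)"
    by (subst lborel_affine[OF c, of t]) simp
  also have "\<dots> = \<bar>c\<bar> ^ DIM('a) *\<^sub>R (LINT x|lborel. f (t + c *\<^sub>R x))"
    by (subst integral_density) (auto simp: integral_distr)
  finally show ?thesis .
qed

lemma integral_lborel_reflect:
  fixes f :: "'a::euclidean_space \<Rightarrow> 'b::{banach, second_countable_topology}"
  assumes "f \<in> borel_measurable borel"
  shows "(LINT x|lborel. f x) = (LINT x|lborel. f (t - x))"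
  using integral_lborel_affine[OF assms, of "-1" t] by simp

text \<open>Substitution of r v for v. This homogeneity is the source of the powers of
  \<open>\<tau>\<close>, of the planar kernel and of |v|^(-13) below.\<close>

lemma integral_japanese_bracket_scale:
  assumes r: "r > 0"
  shows "(LINT v|lborel. 1 / (r\<^sup>2 + (norm (v :: 'a::euclidean_space))\<^sup>2) ^ n)
    = r ^ DIM('a) / r ^ (2 * n) * (LINT v|lborel. 1 / (1 + (norm (v :: 'a))\<^sup>2) ^ n)"
proof -
  have "(LINT v|lborel. 1 / (r\<^sup>2 + (norm (v :: 'a))\<^sup>2) ^ n)
      = \<bar>r\<bar> ^ DIM('a) *\<^sub>R (LINT v|lborel. 1 / (r\<^sup>2 + (norm (r *\<^sub>R (v :: 'a)))\<^sup>2) ^ n)"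
    using r integral_lborel_affine[of "\<lambda>v :: 'a. 1 / (r\<^sup>2 + (norm v)\<^sup>2) ^ n" r 0] by simp
  also have "(\<lambda>v :: 'a. 1 / (r\<^sup>2 + (norm (r *\<^sub>R v))\<^sup>2) ^ n) = (\<lambda>v. (1 / (1 + (norm v)\<^sup>2) ^ n) / r ^ (2 * n))"
  proof
    fix v :: 'a
    have "r\<^sup>2 + (norm (r *\<^sub>R v))\<^sup>2 = r\<^sup>2 * (1 + (norm v)\<^sup>2)"
      using r by (simp add: power_mult_distrib algebra_simps)
    then show "1 / (r\<^sup>2 + (norm (r *\<^sub>R v))\<^sup>2) ^ n = (1 / (1 + (norm v)\<^sup>2) ^ n) / r ^ (2 * n)"
      by (simp add: power_mult_distrib power_mult)
  qed
  finally show ?thesis using r by (simp del: divide_divide_eq_left)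
qed

lemma nn_integral_japanese_bracket:
  assumes "r > 0" "DIM('a) < 2 * n"
  shows "(\<integral>\<^sup>+v. ennreal (1 / (r\<^sup>2 + (norm (v :: 'a::euclidean_space))\<^sup>2) ^ n) \<partial>lborel)
    = ennreal (r ^ DIM('a) / r ^ (2 * n) * (LINT v|lborel. 1 / (1 + (norm (v :: 'a))\<^sup>2) ^ n))"
  unfolding integral_japanese_bracket_scale[OF assms(1), symmetric]
  by (rule nn_integral_eq_integral[OF integrable_japanese_bracket[OF assms]]) simp

lemma integral_japanese_bracket_pos:
  assumes "DIM('a) < 2 * n"
  shows "(LINT v|lborel. 1 / (1 + (norm (v :: 'a::euclidean_space))\<^sup>2) ^ n) > 0"
proof -
  have int: "integrable lborel (\<lambda>v :: 'a. 1 / (1 + (norm v)\<^sup>2) ^ n)"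
    using integrable_japanese_bracket[OF _ assms, of 1] by simp
  have pos: "1 / (1 + (norm v)\<^sup>2) ^ n > 0" for v :: 'a
    by (auto intro!: divide_pos_pos zero_less_power add_pos_nonneg)
  have "(LINT v|lborel. 1 / (1 + (norm (v :: 'a))\<^sup>2) ^ n) \<noteq> 0"
  proof
    assume "(LINT v|lborel. 1 / (1 + (norm (v :: 'a))\<^sup>2) ^ n) = 0"
    then have "AE v :: 'a in lborel. 1 / (1 + (norm v)\<^sup>2) ^ n = 0"
      using integral_nonneg_eq_0_iff_AE[OF int] by simp
    then have "AE v :: 'a in lborel. False"
    proof eventually_elim
      case (elim v)
      then show False using pos[of v] by (simp only: less_irrefl)
    qed
    then show False
      by (simp add: eventually_False ae_filter_eq_bot_iff)
  qed
  moreover have "(LINT v|lborel. 1 / (1 + (norm (v :: 'a))\<^sup>2) ^ n) \<ge> 0"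
    by (intro Bochner_Integration.integral_nonneg) simp
  ultimately show ?thesis by linarith
qed

section \<open>Product integrals and the transverse cut-off\<close>

lemma integrable_lborel_product:
  fixes f :: "'a::euclidean_space \<Rightarrow> real" and g :: "'b::euclidean_space \<Rightarrow> real"
  assumes f: "integrable lborel f" and g: "integrable lborel g"
  shows "integrable lborel (\<lambda>x. f (fst x) * g (snd x))"
    and "(LINT x|lborel. f (fst x) * g (snd x)) = (LINT x|lborel. f x) * (LINT y|lborel. g y)"
proof -
  have [measurable]: "f \<in> borel_measurable borel" "g \<in> borel_measurable borel"
    using f g by auto
  have int: "integrable (lborel \<Otimes>\<^sub>M lborel) (\<lambda>(x, y). f x * g y)"
  proof (rule lborel_pair.Fubini_integrable)
    show "integrable lborel (\<lambda>x. LINT y|lborel. norm (case (x, y) of (x, y) \<Rightarrow> f x * g y))"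
      using f by (simp add: abs_mult)
    show "AE x in lborel. integrable lborel (\<lambda>y. case (x, y) of (x, y) \<Rightarrow> f x * g y)"
      using g by simp
  qed measurable
  then show "integrable lborel (\<lambda>x. f (fst x) * g (snd x))"
    by (simp add: lborel_prod case_prod_unfold)
  have "(LINT x|lborel. f (fst x) * g (snd x)) = (LINT x|(lborel \<Otimes>\<^sub>M lborel). (case x of (x, y) \<Rightarrow> f x * g y))"
    by (simp add: lborel_prod case_prod_unfold)
  also have "\<dots> = (LINT x|lborel. LINT y|lborel. f x * g y)"
    using lborel_pair.integral_fst[OF int] by simp
  finally show "(LINT x|lborel. f (fst x) * g (snd x)) = (LINT x|lborel. f x) * (LINT y|lborel. g y)"
    by simp
qed

lemma nn_integral_lborel_pair:
  fixes f :: "'a::euclidean_space \<times> 'b::euclidean_space \<Rightarrow> ennreal"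
  assumes "f \<in> borel_measurable borel"
  shows "(\<integral>\<^sup>+x. f x \<partial>lborel) = (\<integral>\<^sup>+a. \<integral>\<^sup>+b. f (a, b) \<partial>lborel \<partial>lborel)"
    and "(\<integral>\<^sup>+x. f x \<partial>lborel) = (\<integral>\<^sup>+b. \<integral>\<^sup>+a. f (a, b) \<partial>lborel \<partial>lborel)"
proof -
  have f: "f \<in> borel_measurable (lborel \<Otimes>\<^sub>M lborel)"
    using assms by (simp add: lborel_prod)
  show "(\<integral>\<^sup>+x. f x \<partial>lborel) = (\<integral>\<^sup>+a. \<integral>\<^sup>+b. f (a, b) \<partial>lborel \<partial>lborel)"
    using lborel.nn_integral_fst[OF f] by (simp add: lborel_prod)
  show "(\<integral>\<^sup>+x. f x \<partial>lborel) = (\<integral>\<^sup>+b. \<integral>\<^sup>+a. f (a, b) \<partial>lborel \<partial>lborel)"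
    using lborel_pair.nn_integral_snd[of f] f by (simp add: lborel_prod)
qed

text \<open>A tent function: the estimates rest on its Lipschitz constant 1, its values in [0, 1]
  and its support in the unit ball.\<close>

definition bump :: "'a::real_normed_vector \<Rightarrow> real" where
  "bump y = max 0 (1 - norm y)"

lemma bump_nonneg: "bump y \<ge> 0" and bump_le_1: "bump y \<le> 1"
  by (simp_all add: bump_def)

lemma abs_bump_le_1: "\<bar>bump y\<bar> \<le> 1"
  using bump_nonneg[of y] bump_le_1[of y] by simp

lemma continuous_on_bump: "continuous_on S bump"
  unfolding bump_def by (intro continuous_intros)

lemma borel_measurable_bump [measurable]: "bump \<in> borel_measurable borel"
  by (intro borel_measurable_continuous_onI continuous_on_bump)

lemma bump_diff_le: "\<bar>bump (y - v) - bump y\<bar> \<le> min 1 (norm v)"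
proof -
  have "\<bar>norm (y - v) - norm y\<bar> \<le> norm v"
    using norm_triangle_ineq3[of "y - v" y] by simp
  moreover have "\<bar>max 0 (1 - a) - max 0 (1 - b)\<bar> \<le> min 1 c"
    if "\<bar>a - b\<bar> \<le> c" "a \<ge> 0" "b \<ge> 0" for a b c :: real
    using that by linarith
  ultimately show ?thesis by (simp add: bump_def)
qed

text \<open>The increment is at most min(1, |v|) and vanishes outside two unit balls, centred at 0
  and at \<open>v\<close>; hence the factor 2.\<close>

lemma nn_integral_bump_diff_le:
  "(\<integral>\<^sup>+y. ennreal ((bump (y - v) - bump y)\<^sup>2) \<partial>lborel)
    \<le> ennreal (2 * unit_ball_vol DIM('a) * (min 1 (norm v))\<^sup>2)" for v :: "'a::euclidean_space"
proof -
  let ?m = "(min 1 (norm v))\<^sup>2"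
  have "ennreal ((bump (y - v) - bump y)\<^sup>2)
      \<le> ennreal ?m * indicator (cball 0 1) y + ennreal ?m * indicator (cball v 1) y" for y
  proof (cases "y \<in> cball 0 1 \<or> y \<in> cball v 1")
    case True
    have "(bump (y - v) - bump y)\<^sup>2 \<le> ?m"
      using bump_diff_le[of y v] by (metis abs_ge_zero power2_abs power_mono)
    then have "ennreal ((bump (y - v) - bump y)\<^sup>2) \<le> ennreal ?m" by (rule ennreal_leI)
    with True show ?thesis
      by (auto simp: indicator_def intro: order_trans add_increasing add_increasing2)
  next
    case False
    then have "bump (y - v) = 0" "bump y = 0"
      by (simp_all add: bump_def dist_norm norm_minus_commute)
    then show ?thesis by simp
  qed
  then have "(\<integral>\<^sup>+y. ennreal ((bump (y - v) - bump y)\<^sup>2) \<partial>lborel)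
      \<le> (\<integral>\<^sup>+y. ennreal ?m * indicator (cball 0 1) y + ennreal ?m * indicator (cball v 1) y \<partial>lborel)"
    by (intro nn_integral_mono) simp
  also have "\<dots> = ennreal ?m * emeasure lborel (cball (0 :: 'a) 1) + ennreal ?m * emeasure lborel (cball v 1)"
    by (subst nn_integral_add)
       (auto intro!: borel_measurable_times_ennreal borel_measurable_indicator simp: nn_integral_cmult_indicator)
  also have "\<dots> = ennreal (2 * unit_ball_vol DIM('a) * ?m)"
    by (simp add: emeasure_cball algebra_simps flip: ennreal_mult ennreal_plus)
  finally show ?thesis .
qed

lemma integrable_bump_square: "integrable lborel (\<lambda>y :: 'a::euclidean_space. (bump y)\<^sup>2)"
proof (rule Bochner_Integration.integrable_bound)
  show "integrable lborel (\<lambda>y :: 'a. indicator (cball 0 1) y :: real)"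
    by (simp add: integrable_indicator_iff emeasure_cball)
  show "AE y :: 'a in lborel. norm ((bump y)\<^sup>2) \<le> norm (indicator (cball 0 1) y :: real)"
    by (intro AE_I2) (auto simp: bump_def indicator_def power_le_one)
qed measurable

lemma integral_bump_square_pos: "(LINT y|lborel. (bump (y :: 'a::euclidean_space))\<^sup>2) > 0"
proof -
  have "(LINT y|lborel. (1 / 4) * indicator (cball 0 (1 / 2)) (y :: 'a)) \<le> (LINT y|lborel. (bump (y :: 'a))\<^sup>2)"
  proof (rule integral_mono)
    show "integrable lborel (\<lambda>y :: 'a. (1 / 4) * indicator (cball 0 (1 / 2)) y :: real)"
      by (intro integrable_mult_right) (simp add: integrable_indicator_iff emeasure_cball)
    show "(1 / 4) * indicator (cball 0 (1 / 2)) y \<le> (bump y)\<^sup>2" for y :: 'a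
      using power_mono[of "1 / 2" "bump y" 2] by (auto simp: indicator_def power2_eq_square bump_def)
  qed (rule integrable_bump_square)
  moreover have "(LINT y|lborel. (1 / 4) * indicator (cball 0 (1 / 2)) (y :: 'a)) > (0 :: real)"
    by (simp add: measure_def emeasure_cball)
  ultimately show ?thesis by linarith
qed

text \<open>The double pole at -i tau makes the function integrable on the line, with modulus 1 /
  (tau^2 + s^2); a simple pole would give only square integrability.\<close>

definition dipole :: "real \<Rightarrow> real \<Rightarrow> complex" where
  "dipole \<tau> s = 1 / (complex_of_real s + \<i> * complex_of_real \<tau>) ^ 2"

lemma norm_dipole: "norm (dipole \<tau> s) = 1 / (\<tau>\<^sup>2 + s\<^sup>2)"
proof -
  have "norm (complex_of_real s + \<i> * complex_of_real \<tau>) ^ 2 = \<tau>\<^sup>2 + s\<^sup>2"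
    by (simp add: cmod_power2)
  then show ?thesis by (simp add: dipole_def norm_divide norm_power)
qed

lemma dipole_denominator_nonzero: "\<tau> > 0 \<Longrightarrow> complex_of_real s + \<i> * complex_of_real \<tau> \<noteq> 0"
  by (simp add: complex_eq_iff)

lemma continuous_on_dipole: "\<tau> > 0 \<Longrightarrow> continuous_on S (dipole \<tau>)"
  unfolding dipole_def by (intro continuous_intros) (simp add: dipole_denominator_nonzero)

section \<open>The dipole against the planar and the full Cauchy kernel\<close>

lemma integrable_norm_dipole:
  assumes "\<tau> > 0"
  shows "integrable lborel (\<lambda>\<sigma>. norm (dipole \<tau> (s - \<sigma>)))"
proof -
  have "integrable lborel (\<lambda>\<sigma>. norm (dipole \<tau> \<sigma>))"
    using integrable_japanese_bracket[OF assms, of 1, where 'a = real] by (simp add: norm_dipole)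
  from lborel_integrable_real_affine[OF this, of "-1" s] show ?thesis by simp
qed

lemma integrable_dipole_quotient:
  assumes t: "t > 0" and \<tau>: "\<tau> > 0"
  shows "integrable lborel (\<lambda>\<sigma>. dipole \<tau> (s - \<sigma>) / (complex_of_real t + \<i> * complex_of_real \<sigma>))"
proof (rule Bochner_Integration.integrable_bound)
  show "integrable lborel (\<lambda>\<sigma>. (1 / t) * norm (dipole \<tau> (s - \<sigma>)))"
    by (intro integrable_mult_right integrable_norm_dipole \<tau>)
  show "AE \<sigma> in lborel. norm (dipole \<tau> (s - \<sigma>) / (complex_of_real t + \<i> * complex_of_real \<sigma>))
      \<le> norm ((1 / t) * norm (dipole \<tau> (s - \<sigma>)))"
  proof (intro AE_I2)
    fix \<sigma>
    have "t \<le> norm (complex_of_real t + \<i> * complex_of_real \<sigma>)"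
      using abs_Re_le_cmod[of "complex_of_real t + \<i> * complex_of_real \<sigma>"] t by simp
    then show "norm (dipole \<tau> (s - \<sigma>) / (complex_of_real t + \<i> * complex_of_real \<sigma>))
        \<le> norm ((1 / t) * norm (dipole \<tau> (s - \<sigma>)))"
      using t by (simp add: norm_divide frac_le)
  qed
  have "continuous_on UNIV (\<lambda>\<sigma>. dipole \<tau> (s - \<sigma>) / (complex_of_real t + \<i> * complex_of_real \<sigma>))"
    using t by (intro continuous_intros continuous_on_compose2[OF continuous_on_dipole[OF \<tau>, of UNIV]])
      (auto simp: complex_eq_iff)
  then show "(\<lambda>\<sigma>. dipole \<tau> (s - \<sigma>) / (complex_of_real t + \<i> * complex_of_real \<sigma>)) \<in> borel_measurable lborel"
    by (simp add: borel_measurable_continuous_onI)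
qed

text \<open>Both poles of \<open>dipole \<tau> (s - \<sigma>) / (t + \<i> \<sigma>)\<close> lie in the upper half-plane.\<close>

lemma integral_dipole_eq_0:
  assumes t: "t > 0" and \<tau>: "\<tau> > 0"
  shows "(LINT \<sigma>|lborel. dipole \<tau> (s - \<sigma>) / (complex_of_real t + \<i> * complex_of_real \<sigma>)) = 0"
proof -
  define f where "f z = 1 / ((complex_of_real t + \<i> * z) * (complex_of_real s - z + \<i> * complex_of_real \<tau>) ^ 2)" for z
  have f_real: "f (complex_of_real \<sigma>) = dipole \<tau> (s - \<sigma>) / (complex_of_real t + \<i> * complex_of_real \<sigma>)" for \<sigma>
    by (simp add: f_def dipole_def field_simps)
  have nz: "complex_of_real t + \<i> * z \<noteq> 0" "complex_of_real s - z + \<i> * complex_of_real \<tau> \<noteq> 0"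
    if "Im z < min t \<tau>" for z
    using that by (auto simp: complex_eq_iff)
  have "(LINT \<sigma>|lborel. f (complex_of_real \<sigma>)) = 0"
  proof (rule integral_real_line_eq_0)
    show "f holomorphic_on {z. Im z < min t \<tau>}"
      unfolding f_def by (intro holomorphic_intros) (use nz in auto)
    show "min t \<tau> > 0" using t \<tau> by simp
    \<comment> \<open>In this range each of the three linear factors of the denominator is at least
      |z| / 2, which is at least 1; dropping one of them leaves 4 / |z|^2.\<close>
    show "norm (f z) \<le> 8 / (norm z)\<^sup>2" if "norm z \<ge> 2 * (\<bar>s\<bar> + \<tau> + t + 1)" for z
    proof -
      let ?r = "norm z / 2"
      have r: "?r \<ge> 1" using that t \<tau> by simp
      have "norm (\<i> * z) \<le> norm (complex_of_real t + \<i> * z) + norm (complex_of_real t)"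
        using norm_triangle_ineq4[of "complex_of_real t + \<i> * z" "complex_of_real t"] by simp
      then have 1: "?r \<le> norm (complex_of_real t + \<i> * z)"
        using that t \<tau> by (simp add: norm_mult)
      have "norm z \<le> norm (complex_of_real s + \<i> * complex_of_real \<tau>)
          + norm (complex_of_real s - z + \<i> * complex_of_real \<tau>)"
        using norm_triangle_ineq4[of "complex_of_real s + \<i> * complex_of_real \<tau>" "complex_of_real s - z + \<i> * complex_of_real \<tau>"]
        by simp
      moreover have "norm (complex_of_real s + \<i> * complex_of_real \<tau>) \<le> \<bar>s\<bar> + \<tau>"
        using norm_triangle_ineq[of "complex_of_real s" "\<i> * complex_of_real \<tau>"] \<tau> by (simp add: norm_mult)
      ultimately have 2: "?r \<le> norm (complex_of_real s - z + \<i> * complex_of_real \<tau>)"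
        using that t \<tau> by simp
      have "?r * 1 * ?r\<^sup>2 \<le> norm (complex_of_real t + \<i> * z) * norm (complex_of_real s - z + \<i> * complex_of_real \<tau>) ^ 2"
        using 1 2 r by (intro mult_mono power_mono) auto
      moreover have "1 * ?r\<^sup>2 \<le> ?r * 1 * ?r\<^sup>2"
        using r by (intro mult_right_mono) auto
      ultimately have "?r\<^sup>2 \<le> norm ((complex_of_real t + \<i> * z) * (complex_of_real s - z + \<i> * complex_of_real \<tau>) ^ 2)"
        by (simp add: norm_mult norm_power)
      moreover have "?r\<^sup>2 > 0" using r by (intro zero_less_power) linarith
      ultimately have "norm (f z) \<le> 1 / ?r\<^sup>2"
        unfolding f_def norm_divide by (simp add: frac_le)
      also have "\<dots> = 4 / (norm z)\<^sup>2" by (simp add: power_divide)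
      also have "\<dots> \<le> 8 / (norm z)\<^sup>2" by (intro divide_right_mono) auto
      finally show ?thesis .
    qed
    show "integrable lborel (\<lambda>\<sigma>. f (complex_of_real \<sigma>))"
      unfolding f_real by (rule integrable_dipole_quotient[OF t \<tau>])
  qed
  then show ?thesis by (simp add: f_real)
qed

text \<open>The kernel alone has the critical exponent and is not integrable at infinity. Its norm
  is bounded by a power of \<open>1 + norm (snd w)\<close>, integrable in the transverse variable,
  while the dipole is integrable along the axis.\<close>

lemma integrable_kernel_dipole:
  assumes t: "t > 0" and \<tau>: "\<tau> > 0"
  shows "integrable lborel (\<lambda>w :: real \<times> 'a::euclidean_space.
    1 / norm (t :: real, w) ^ Suc DIM('a) * norm (dipole \<tau> (s - fst w)))"
proof (rule Bochner_Integration.integrable_bound)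
  define m where "m = min t 1"
  have m: "0 < m" "m \<le> t" "m \<le> 1" using t by (auto simp: m_def)
  let ?n = "Suc DIM('a)"
  have "integrable lborel (\<lambda>w :: real \<times> 'a. norm (dipole \<tau> (s - fst w)) * (1 / (1 + norm (snd w)) ^ ?n))"
    by (rule integrable_lborel_product[OF integrable_norm_dipole[OF \<tau>] integrable_inverse_power_norm])
  then show "integrable lborel (\<lambda>w :: real \<times> 'a. (2 / m) ^ ?n *
      (norm (dipole \<tau> (s - fst w)) * (1 / (1 + norm (snd w)) ^ ?n)))"
    by (rule integrable_mult_right)
  show "AE w :: real \<times> 'a in lborel. norm (1 / norm (t, w) ^ ?n * norm (dipole \<tau> (s - fst w)))
      \<le> norm ((2 / m) ^ ?n * (norm (dipole \<tau> (s - fst w)) * (1 / (1 + norm (snd w)) ^ ?n)))"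
  proof (intro AE_I2)
    fix w :: "real \<times> 'a"
    have "t \<le> norm (t, w)" "norm (snd w) \<le> norm (t, w)"
      using norm_fst_le[of t w] norm_snd_le[of w t] norm_snd_le[of "snd w" "fst w"] t by auto
    moreover have "m * norm (snd w) \<le> norm (snd w)"
      using m by (simp add: mult_left_le_one_le)
    ultimately have le: "m / 2 * (1 + norm (snd w)) \<le> norm (t, w)"
      using m by (simp add: algebra_simps)
    have pos: "m / 2 * (1 + norm (snd w)) > 0"
      using m by (simp add: add_pos_nonneg)
    have "1 / norm (t, w) ^ ?n \<le> 1 / (m / 2 * (1 + norm (snd w))) ^ ?n"
      using le pos m add_pos_nonneg[OF zero_less_one norm_ge_zero[of "snd w"]]
      by (intro divide_left_mono power_mono mult_pos_pos zero_less_power) (use t in \<open>auto simp: zero_prod_def\<close>)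
    also have "\<dots> = (2 / m) ^ ?n * (1 / (1 + norm (snd w)) ^ ?n)"
      unfolding power_mult_distrib power_divide by simp
    finally have "1 / norm (t, w) ^ ?n * norm (dipole \<tau> (s - fst w))
        \<le> (2 / m) ^ ?n * (1 / (1 + norm (snd w)) ^ ?n) * norm (dipole \<tau> (s - fst w))"
      by (intro mult_right_mono) auto
    then have "\<bar>1 / norm (t, w) ^ ?n * norm (dipole \<tau> (s - fst w))\<bar>
        \<le> (2 / m) ^ ?n * (norm (dipole \<tau> (s - fst w)) * (1 / (1 + norm (snd w)) ^ ?n))"
      by (simp add: mult_ac del: power_Suc)
    then show "norm (1 / norm (t, w) ^ ?n * norm (dipole \<tau> (s - fst w)))
      \<le> norm ((2 / m) ^ ?n * (norm (dipole \<tau> (s - fst w)) * (1 / (1 + norm (snd w)) ^ ?n)))"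
      unfolding real_norm_def by (rule order_trans[OF _ abs_ge_self])
  qed
  have "continuous_on UNIV (\<lambda>w :: real \<times> 'a. 1 / norm (t, w) ^ ?n * norm (dipole \<tau> (s - fst w)))"
    using t by (intro continuous_intros continuous_on_compose2[OF continuous_on_dipole[OF \<tau>, of UNIV]])
       (auto simp: zero_prod_def)
  then show "(\<lambda>w :: real \<times> 'a. 1 / norm (t, w) ^ ?n * norm (dipole \<tau> (s - fst w))) \<in> borel_measurable lborel"
    by (simp add: borel_measurable_continuous_onI)
qed

section \<open>Square-integral bound for the remainder, uniform in the height\<close>

lemma nn_integral_dipole_shift:
  assumes "\<tau> > 0"
  shows "(\<integral>\<^sup>+s. ennreal (1 / (\<tau>\<^sup>2 + (s - \<sigma>)\<^sup>2)) \<partial>lborel) = ennreal ((LINT s|lborel. 1 / (1 + (s :: real)\<^sup>2)) / \<tau>)"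
    and "(\<integral>\<^sup>+s. ennreal (1 / (\<tau>\<^sup>2 + (\<sigma> - s)\<^sup>2)) \<partial>lborel) = ennreal ((LINT s|lborel. 1 / (1 + (s :: real)\<^sup>2)) / \<tau>)"
proof -
  have eq: "(\<integral>\<^sup>+s. ennreal (1 / (\<tau>\<^sup>2 + s\<^sup>2)) \<partial>lborel) = ennreal ((LINT s|lborel. 1 / (1 + (s :: real)\<^sup>2)) / \<tau>)"
    using nn_integral_japanese_bracket[OF assms, of 1, where 'a = real] assms
    by (simp add: power2_eq_square)
  show "(\<integral>\<^sup>+s. ennreal (1 / (\<tau>\<^sup>2 + (s - \<sigma>)\<^sup>2)) \<partial>lborel) = ennreal ((LINT s|lborel. 1 / (1 + (s :: real)\<^sup>2)) / \<tau>)"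
    using nn_integral_real_affine[of "\<lambda>s. ennreal (1 / (\<tau>\<^sup>2 + s\<^sup>2))" 1 "- \<sigma>"] eq
    by (simp add: algebra_simps)
  show "(\<integral>\<^sup>+s. ennreal (1 / (\<tau>\<^sup>2 + (\<sigma> - s)\<^sup>2)) \<partial>lborel) = ennreal ((LINT s|lborel. 1 / (1 + (s :: real)\<^sup>2)) / \<tau>)"
    using nn_integral_real_affine[of "\<lambda>s. ennreal (1 / (\<tau>\<^sup>2 + s\<^sup>2))" "-1" \<sigma>] eq
    by (simp add: algebra_simps)
qed

text \<open>Cauchy--Schwarz with the weight \<open>W(v) = |v|\<^sup>-\<^sup>1\<^sup>3\<^sup>/\<^sup>2 min(1, |v|)\<close>, for which
  \<open>\<integral> min(1, |v|)\<^sup>2 (\<sigma>\<^sup>2 + |v|\<^sup>2)\<^sup>-\<^sup>7 d\<sigma> / W(v)\<close> is again a multiple of \<open>W(v)\<close>.\<close>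

lemma singular_remainder_estimate:
  obtains S :: "real \<Rightarrow> real \<Rightarrow> real \<times> (real ^ 6) \<Rightarrow> ennreal" and C :: real where
    "\<And>t \<tau>. S t \<tau> \<in> borel_measurable borel"
    "\<And>t \<tau> x. \<tau> > 0 \<Longrightarrow> t > 0 \<Longrightarrow>
      (\<integral>\<^sup>+w. ennreal (1 / norm (t, w) ^ 7 * \<bar>bump (snd x - snd w) - bump (snd x)\<bar>
        * (1 / (\<tau>\<^sup>2 + (fst x - fst w)\<^sup>2))) \<partial>lborel)\<^sup>2 \<le> S t \<tau> x"
    "\<And>t \<tau>. \<tau> > 0 \<Longrightarrow> t > 0 \<Longrightarrow> (\<integral>\<^sup>+x. S t \<tau> x \<partial>lborel) \<le> ennreal (C / \<tau>\<^sup>2)"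
    "C \<ge> 0"
proof -
  define W :: "real ^ 6 \<Rightarrow> real" where "W v = min 1 (norm v) / sqrt (norm v) ^ 13" for v
  have W_nonneg: "W v \<ge> 0" for v by (simp add: W_def)
  have W_pos: "W v > 0" if "v \<noteq> 0" for v using that by (simp add: W_def)
  have W_meas [measurable]: "W \<in> borel_measurable borel" unfolding W_def[abs_def] by measurable
  define I where "I = enn2real (\<integral>\<^sup>+v. ennreal (W v) \<partial>lborel)"
  have I: "(\<integral>\<^sup>+v. ennreal (W v) \<partial>lborel) = ennreal I" "I \<ge> 0"
    using nn_integral_critical_weight_finite[where 'a = "real ^ 6"]
    unfolding I_def by (auto simp: W_def less_top)
  define A where "A = (LINT s|lborel. 1 / (1 + (s :: real)\<^sup>2))"
  define B where "B = (LINT s|lborel. 1 / (1 + (s :: real)\<^sup>2) ^ 7)"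
  define V where "V = 2 * unit_ball_vol (real 6)"
  have nonnegs: "A \<ge> 0" "B \<ge> 0" "V \<ge> 0"
    by (auto simp: A_def B_def V_def intro!: Bochner_Integration.integral_nonneg)
  define D where "D x w = bump (snd x - snd w) - bump (snd x)" for x w :: "real \<times> (real ^ 6)"
  define d where "d \<tau> x w = 1 / (\<tau>\<^sup>2 + (fst x - fst w)\<^sup>2)" for \<tau> :: real and x w :: "real \<times> (real ^ 6)"
  define N where "N t w = norm (t, w)" for t :: real and w :: "real \<times> (real ^ 6)"
  \<comment> \<open>The second factor of the weighted Cauchy-Schwarz inequality, before integration.
    The dipole enters both factors to the first power, so that it is always measured in L^1.\<close>
  define Q where "Q t \<tau> x w = ennreal (1 / (N t w ^ 14 * W (snd w))) * (ennreal ((D x w)\<^sup>2) * ennreal (d \<tau> x w))"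
    for t \<tau> x w
  have pair_meas: "(\<lambda>w. (x, w)) \<in> borel_measurable borel" "(\<lambda>w. (w, x)) \<in> borel_measurable borel"
    for x :: "real \<times> (real ^ 6)"
    by (auto intro!: borel_measurable_continuous_onI continuous_intros)
  have D_joint [measurable]: "(\<lambda>p. D (fst p) (snd p)) \<in> borel_measurable borel"
    unfolding D_def
    by (intro borel_measurable_continuous_onI continuous_intros continuous_on_compose2[OF continuous_on_bump[of UNIV]]) auto
  have D_meas [measurable]: "D x \<in> borel_measurable borel" "(\<lambda>x. D x w) \<in> borel_measurable borel" for x w
    using measurable_compose[OF pair_meas(1) D_joint] measurable_compose[OF pair_meas(2) D_joint] by simp_all
  have d_joint [measurable]: "(\<lambda>p. d \<tau> (fst p) (snd p)) \<in> borel_measurable borel" for \<tau>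
  proof -
    have "(\<lambda>p :: (real \<times> (real ^ 6)) \<times> (real \<times> (real ^ 6)). fst (fst p) - fst (snd p)) \<in> borel_measurable borel"
      by (intro borel_measurable_continuous_onI continuous_intros)
    from measurable_compose[OF this, of "\<lambda>r. 1 / (\<tau>\<^sup>2 + r\<^sup>2)" borel] show ?thesis
      unfolding d_def by simp
  qed
  have d_meas [measurable]: "d \<tau> x \<in> borel_measurable borel" "(\<lambda>x. d \<tau> x w) \<in> borel_measurable borel" for \<tau> x w
    using measurable_compose[OF pair_meas(1) d_joint] measurable_compose[OF pair_meas(2) d_joint] by simp_all
  have N_meas [measurable]: "N t \<in> borel_measurable borel" for t
    unfolding N_def[abs_def] by (intro borel_measurable_continuous_onI continuous_intros)
  have N_joint [measurable]: "(\<lambda>p :: (real \<times> (real ^ 6)) \<times> (real \<times> (real ^ 6)). N t (snd p)) \<in> borel_measurable borel" for t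
    unfolding N_def by (intro borel_measurable_continuous_onI continuous_intros)
  have snd_meas [measurable]: "(snd :: real \<times> (real ^ 6) \<Rightarrow> _) \<in> borel_measurable borel"
    by (intro borel_measurable_continuous_onI continuous_intros)
  have W_snd [measurable]: "(\<lambda>w :: real \<times> (real ^ 6). W (snd w)) \<in> borel_measurable borel"
    by (rule measurable_compose[OF snd_meas W_meas])
  have W_joint [measurable]: "(\<lambda>p :: (real \<times> (real ^ 6)) \<times> (real \<times> (real ^ 6)). W (snd (snd p))) \<in> borel_measurable borel"
    by (rule measurable_compose[OF _ W_meas]) (intro borel_measurable_continuous_onI continuous_intros)
  have d_nonneg: "d \<tau> x w \<ge> 0" for \<tau> x w by (simp add: d_def)
  have Q_meas: "(\<lambda>(x, w). Q t \<tau> x w) \<in> borel_measurable (lborel \<Otimes>\<^sub>M lborel)" for t \<tau>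
    unfolding lborel_prod Q_def[abs_def] case_prod_unfold by measurable
  define S where "S t \<tau> x = ennreal (A / \<tau> * I) * (\<integral>\<^sup>+w. Q t \<tau> x w \<partial>lborel)" for t \<tau> x
  show thesis
  \<comment> \<open>\<open>A * I\<close> comes from the factor containing the weight,
    \<open>V * A * B * I\<close> from the other one. Each carries one 1/tau from a dipole
    integral.\<close>
  proof (rule that[of S "(A * I) * (V * A * B * I)"])
    show "S t \<tau> \<in> borel_measurable borel" for t \<tau>
    proof -
      have "(\<lambda>x. \<integral>\<^sup>+w. Q t \<tau> x w \<partial>lborel) \<in> borel_measurable lborel"
        using lborel.borel_measurable_nn_integral[OF Q_meas[of t \<tau>]] by simp
      then show ?thesis unfolding S_def[abs_def] by simp
    qed
    show "A * I * (V * A * B * I) \<ge> 0" using nonnegs I by simp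
    fix t \<tau> :: real assume \<tau>: "\<tau> > 0" and t: "t > 0"
    have N_pos: "N t w > 0" for w using t by (auto simp: N_def zero_prod_def)
    show "(\<integral>\<^sup>+w. ennreal (1 / norm (t, w) ^ 7 * \<bar>bump (snd x - snd w) - bump (snd x)\<bar>
        * (1 / (\<tau>\<^sup>2 + (fst x - fst w)\<^sup>2))) \<partial>lborel)\<^sup>2 \<le> S t \<tau> x" for x
    proof -
      let ?f = "\<lambda>w. ennreal (sqrt (W (snd w) * d \<tau> x w))"
      let ?g = "\<lambda>w. ennreal (1 / N t w ^ 7 * \<bar>D x w\<bar> * sqrt (d \<tau> x w / W (snd w)))"
      \<comment> \<open>Where \<open>snd w = 0\<close> the weight is 0 and cannot be divided out,
        but the increment of the cut-off vanishes there too.\<close>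
      have fg: "ennreal (1 / N t w ^ 7 * \<bar>D x w\<bar> * d \<tau> x w) = ?f w * ?g w" for w
      proof (cases "snd w = 0")
        case True
        then show ?thesis by (simp add: D_def)
      next
        case False
        have "sqrt (W (snd w) * d \<tau> x w) * sqrt (d \<tau> x w / W (snd w)) = d \<tau> x w"
          using W_pos[OF False] d_nonneg[of \<tau> x w] by (simp flip: real_sqrt_mult)
        then have "sqrt (W (snd w) * d \<tau> x w) * (1 / N t w ^ 7 * \<bar>D x w\<bar> * sqrt (d \<tau> x w / W (snd w)))
            = 1 / N t w ^ 7 * \<bar>D x w\<bar> * d \<tau> x w"
          by (metis mult.left_commute)
        from this[symmetric] show ?thesis
          using W_nonneg[of "snd w"] d_nonneg[of \<tau> x w] N_pos[of w]
          by (simp only:) (subst ennreal_mult, auto)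
      qed
      have f2: "(?f w)\<^sup>2 = ennreal (W (snd w) * d \<tau> x w)" for w
        using W_nonneg[of "snd w"] d_nonneg[of \<tau> x w] by (simp add: ennreal_power)
      have g2: "(?g w)\<^sup>2 = Q t \<tau> x w" for w
        using W_nonneg[of "snd w"] d_nonneg[of \<tau> x w] N_pos[of w]
        by (simp add: ennreal_power Q_def power_mult_distrib power_divide flip: ennreal_mult power_mult)
      have "(\<integral>\<^sup>+w. ?f w * ?g w \<partial>lborel)\<^sup>2 \<le> (\<integral>\<^sup>+w. (?f w)\<^sup>2 \<partial>lborel) * (\<integral>\<^sup>+w. (?g w)\<^sup>2 \<partial>lborel)"
        by (rule Cauchy_Schwarz_nn_integral) measurable
      also have "(\<integral>\<^sup>+w. (?f w)\<^sup>2 \<partial>lborel) = ennreal (A / \<tau> * I)"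
      proof -
        have "(\<integral>\<^sup>+w. (?f w)\<^sup>2 \<partial>lborel)
            = (\<integral>\<^sup>+\<sigma>. \<integral>\<^sup>+v. ennreal (1 / (\<tau>\<^sup>2 + (fst x - \<sigma>)\<^sup>2)) * ennreal (W v) \<partial>lborel \<partial>lborel)"
          unfolding f2 by (subst nn_integral_lborel_pair(1))
            (measurable, simp add: d_def W_nonneg mult.commute flip: ennreal_mult)
        also have "\<dots> = ennreal (A / \<tau>) * ennreal I"
          by (simp add: nn_integral_cmult nn_integral_multc I nn_integral_dipole_shift(2)[OF \<tau>] A_def)
        finally show ?thesis using nonnegs I \<tau> by (simp flip: ennreal_mult)
      qed
      finally have "(\<integral>\<^sup>+w. ennreal (1 / N t w ^ 7 * \<bar>D x w\<bar> * d \<tau> x w) \<partial>lborel)\<^sup>2 \<le> S t \<tau> x"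
        unfolding fg S_def g2 .
      then show ?thesis unfolding N_def D_def d_def .
    qed
    \<comment> \<open>With \<open>x\<close> integrated first, the dipole and the increment of the
      cut-off depend on separate coordinates and their integrals factor.\<close>
    have "(\<integral>\<^sup>+x. \<integral>\<^sup>+w. Q t \<tau> x w \<partial>lborel \<partial>lborel) = (\<integral>\<^sup>+w. \<integral>\<^sup>+x. Q t \<tau> x w \<partial>lborel \<partial>lborel)"
      using lborel_pair.Fubini'[OF Q_meas[of t \<tau>]] by simp
    also have "\<dots> \<le> (\<integral>\<^sup>+w. ennreal (V * A / \<tau>) * (ennreal ((min 1 (norm (snd w)))\<^sup>2) * ennreal (1 / (N t w ^ 14 * W (snd w)))) \<partial>lborel)"
    proof (rule nn_integral_mono)
      fix w :: "real \<times> (real ^ 6)"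
      have eq: "(\<integral>\<^sup>+x. Q t \<tau> x w \<partial>lborel) = ennreal (1 / (N t w ^ 14 * W (snd w))) *
          (\<integral>\<^sup>+x. ennreal ((D x w)\<^sup>2) * ennreal (d \<tau> x w) \<partial>lborel)"
        unfolding Q_def by (rule nn_integral_cmult) measurable
      have "(\<integral>\<^sup>+x. ennreal ((D x w)\<^sup>2) * ennreal (d \<tau> x w) \<partial>lborel)
          = (\<integral>\<^sup>+s. \<integral>\<^sup>+y. ennreal (1 / (\<tau>\<^sup>2 + (s - fst w)\<^sup>2)) * ennreal ((bump (y - snd w) - bump y)\<^sup>2) \<partial>lborel \<partial>lborel)"
        by (subst nn_integral_lborel_pair(1)) (measurable, simp add: D_def d_def mult.commute)
      also have "\<dots> = ennreal (A / \<tau>) * (\<integral>\<^sup>+y. ennreal ((bump (y - snd w) - bump y)\<^sup>2) \<partial>lborel)"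
        by (simp add: nn_integral_cmult nn_integral_multc nn_integral_dipole_shift(1)[OF \<tau>] A_def)
      also have "\<dots> \<le> ennreal (A / \<tau>) * ennreal (V * (min 1 (norm (snd w)))\<^sup>2)"
        using nn_integral_bump_diff_le[of "snd w"] by (intro mult_left_mono) (auto simp: V_def)
      also have "\<dots> = ennreal (V * A / \<tau>) * ennreal ((min 1 (norm (snd w)))\<^sup>2)"
        using nonnegs \<tau> by (simp add: mult_ac flip: ennreal_mult)
      finally have le: "(\<integral>\<^sup>+x. ennreal ((D x w)\<^sup>2) * ennreal (d \<tau> x w) \<partial>lborel)
          \<le> ennreal (V * A / \<tau>) * ennreal ((min 1 (norm (snd w)))\<^sup>2)" .
      show "(\<integral>\<^sup>+x. Q t \<tau> x w \<partial>lborel) \<le> ennreal (V * A / \<tau>) *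
          (ennreal ((min 1 (norm (snd w)))\<^sup>2) * ennreal (1 / (N t w ^ 14 * W (snd w))))"
        unfolding eq using mult_right_mono[OF le zero_le, of "ennreal (1 / (N t w ^ 14 * W (snd w)))"]
        by (simp only: mult.assoc mult.commute[of "ennreal (1 / (N t w ^ 14 * W (snd w)))"])
    qed
    also have "\<dots> = ennreal (V * A / \<tau>) *
        (\<integral>\<^sup>+w. ennreal ((min 1 (norm (snd w)))\<^sup>2) * ennreal (1 / (N t w ^ 14 * W (snd w))) \<partial>lborel)"
      by (rule nn_integral_cmult) measurable
    also have "(\<integral>\<^sup>+w. ennreal ((min 1 (norm (snd w)))\<^sup>2) * ennreal (1 / (N t w ^ 14 * W (snd w))) \<partial>lborel)
        = (\<integral>\<^sup>+v. \<integral>\<^sup>+\<sigma>. ennreal ((min 1 (norm v))\<^sup>2) * ennreal (1 / (N t (\<sigma>, v) ^ 14 * W v)) \<partial>lborel \<partial>lborel)"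
      by (subst nn_integral_lborel_pair(2)) simp_all
    also have "\<dots> \<le> (\<integral>\<^sup>+v. ennreal B * ennreal (W v) \<partial>lborel)"
    proof (rule nn_integral_mono)
      fix v :: "real ^ 6"
      show "(\<integral>\<^sup>+\<sigma>. ennreal ((min 1 (norm v))\<^sup>2) * ennreal (1 / (N t (\<sigma>, v) ^ 14 * W v)) \<partial>lborel)
          \<le> ennreal B * ennreal (W v)"
      proof (cases "v = 0")
        case False
        let ?m = "(min 1 (norm v))\<^sup>2"
        have nv: "norm v > 0" using False by simp
        \<comment> \<open>Dropping t^2 from the norm makes the bound independent of the height;
          \<open>v \<noteq> 0\<close> keeps the denominator positive.\<close>
        have "ennreal ?m * ennreal (1 / (N t (\<sigma>, v) ^ 14 * W v))
            \<le> ennreal (?m / W v) * ennreal (1 / ((norm v)\<^sup>2 + (norm \<sigma>)\<^sup>2) ^ 7)" for \<sigma>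
        proof -
          have "(norm v)\<^sup>2 + (norm \<sigma>)\<^sup>2 \<le> (N t (\<sigma>, v))\<^sup>2"
            by (simp add: N_def norm_prod_def)
          then have "((norm v)\<^sup>2 + (norm \<sigma>)\<^sup>2) ^ 7 \<le> ((N t (\<sigma>, v))\<^sup>2) ^ 7"
            by (intro power_mono) auto
          then have "((norm v)\<^sup>2 + (norm \<sigma>)\<^sup>2) ^ 7 \<le> N t (\<sigma>, v) ^ 14"
            by (simp flip: power_mult)
          moreover have "((norm v)\<^sup>2 + (norm \<sigma>)\<^sup>2) ^ 7 > 0"
            using nv by (intro zero_less_power add_pos_nonneg) auto
          ultimately have "1 / N t (\<sigma>, v) ^ 14 \<le> 1 / ((norm v)\<^sup>2 + (norm \<sigma>)\<^sup>2) ^ 7"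
            by (intro frac_le) auto
          then have "?m / W v * (1 / N t (\<sigma>, v) ^ 14) \<le> ?m / W v * (1 / ((norm v)\<^sup>2 + (norm \<sigma>)\<^sup>2) ^ 7)"
            by (rule mult_left_mono) (simp add: W_nonneg)
          then have "ennreal (?m / W v * (1 / N t (\<sigma>, v) ^ 14)) \<le> ennreal (?m / W v * (1 / ((norm v)\<^sup>2 + (norm \<sigma>)\<^sup>2) ^ 7))"
            by (rule ennreal_leI)
          moreover have "ennreal ?m * ennreal (1 / (N t (\<sigma>, v) ^ 14 * W v)) = ennreal (?m / W v * (1 / N t (\<sigma>, v) ^ 14))"
            using W_nonneg[of v] N_pos[of "(\<sigma>, v)"] by (simp add: mult.commute flip: ennreal_mult)
          moreover have "ennreal (?m / W v) * ennreal (1 / ((norm v)\<^sup>2 + (norm \<sigma>)\<^sup>2) ^ 7)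
              = ennreal (?m / W v * (1 / ((norm v)\<^sup>2 + (norm \<sigma>)\<^sup>2) ^ 7))"
            by (rule ennreal_mult[symmetric]) (simp_all add: W_nonneg)
          ultimately show ?thesis by (simp only:)
        qed
        then have "(\<integral>\<^sup>+\<sigma>. ennreal ?m * ennreal (1 / (N t (\<sigma>, v) ^ 14 * W v)) \<partial>lborel)
            \<le> (\<integral>\<^sup>+\<sigma>. ennreal (?m / W v) * ennreal (1 / ((norm v)\<^sup>2 + (norm (\<sigma>::real))\<^sup>2) ^ 7) \<partial>lborel)"
          by (intro nn_integral_mono) simp
        also have "\<dots> = ennreal (?m / W v) * ennreal (norm v / norm v ^ 14 * B)"
          using nn_integral_japanese_bracket[OF nv, of 7, where 'a = real]
          by (subst nn_integral_cmult) (auto simp: B_def)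
        also have "\<dots> = ennreal (?m / W v * (norm v / norm v ^ 14 * B))"
          using W_nonneg[of v] nonnegs by (simp flip: ennreal_mult)
        also have "?m / W v * (norm v / norm v ^ 14 * B) = B * W v"
        proof -
          define r where "r = sqrt (norm v)"
          define m where "m = min 1 (norm v)"
          have r: "r > 0" "norm v = r ^ 2" using nv by (auto simp: r_def)
          have m: "m > 0" using nv by (simp add: m_def)
          have "m\<^sup>2 / (m / r ^ 13) * (r ^ 2 / (r ^ 2) ^ 14 * B) = B * (m / r ^ 13)"
            using r(1) m by (simp add: field_simps eval_nat_numeral)
          then show ?thesis
            unfolding W_def r_def[symmetric] m_def[symmetric] by (simp only: r(2))
        qed
        finally show ?thesis using nonnegs W_nonneg[of v] by (simp flip: ennreal_mult)
      qed simp
    qed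
    also have "\<dots> = ennreal (B * I)"
      using nonnegs I by (simp add: nn_integral_cmult flip: ennreal_mult)
    finally have "(\<integral>\<^sup>+x. \<integral>\<^sup>+w. Q t \<tau> x w \<partial>lborel \<partial>lborel) \<le> ennreal (V * A / \<tau>) * ennreal (B * I)"
      by (simp add: mult_left_mono)
    moreover have "(\<integral>\<^sup>+x. S t \<tau> x \<partial>lborel) = ennreal (A / \<tau> * I) * (\<integral>\<^sup>+x. \<integral>\<^sup>+w. Q t \<tau> x w \<partial>lborel \<partial>lborel)"
      unfolding S_def using lborel.borel_measurable_nn_integral[OF Q_meas[of t \<tau>]]
      by (intro nn_integral_cmult) simp
    ultimately have "(\<integral>\<^sup>+x. S t \<tau> x \<partial>lborel) \<le> ennreal (A / \<tau> * I) * (ennreal (V * A / \<tau>) * ennreal (B * I))"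
      by (simp add: mult_left_mono)
    also have "\<dots> = ennreal (A / \<tau> * I * (V * A / \<tau> * (B * I)))"
      using nonnegs I \<tau> by (simp flip: ennreal_mult)
    also have "A / \<tau> * I * (V * A / \<tau> * (B * I)) = A * I * (V * A * B * I) / \<tau>\<^sup>2"
      by (simp add: power2_eq_square field_simps)
    finally show "(\<integral>\<^sup>+x. S t \<tau> x \<partial>lborel) \<le> ennreal (A * I * (V * A * B * I) / \<tau>\<^sup>2)" .
  qed
qed

section \<open>The case of an orthonormal pair\<close>

text \<open>\<open>a\<close> and \<open>b\<close> are arbitrary orthonormal octonions, whereas
  \<open>w\<close> is imaginary and hence a direction in the boundary. \<open>L\<close> takes the
  first coordinate axis to that direction.\<close>

locale octonion_plane =
  fixes a b :: octonion and w :: "real ^ 7" and L :: "real \<times> (real ^ 6) \<Rightarrow> real ^ 7"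
  assumes norm_a: "norm a = 1" and norm_b: "norm b = 1" and ab: "inner a b = 0"
    and wb: "(0, w) \<odot> b = a" and wa: "(0, w) \<odot> a = - b"
    and lin_L: "linear L" and norm_L: "\<And>x. norm (L x) = norm x" and L_axis: "L (1, 0) = w"
    and L_lborel: "distr lborel borel L = lborel"
begin

text \<open>Identifies the span of \<open>b\<close> and \<open>a\<close> with the complex numbers,
  \<open>b\<close> being 1 and \<open>a\<close> being i, so that left multiplication by
  \<open>(0, w)\<close> becomes multiplication by i.\<close>

definition J :: "complex \<Rightarrow> octonion" where
  "J z = Re z *\<^sub>R b + Im z *\<^sub>R a"

lemma bounded_linear_J: "bounded_linear J"
  unfolding J_def
  by (intro bounded_linear_add bounded_linear_scaleR_const bounded_linear_Re bounded_linear_Im)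

lemma norm_J: "norm (J z) = norm z"
proof -
  have "inner a a = 1" "inner b b = 1" "inner b a = 0"
    using norm_a norm_b ab by (simp_all add: norm_eq_1 inner_commute)
  then have "inner (J z) (J z) = (Re z)\<^sup>2 + (Im z)\<^sup>2"
    using ab by (simp add: J_def inner_add power2_eq_square)
  then have "(norm (J z))\<^sup>2 = (norm z)\<^sup>2"
    by (simp add: power2_norm_eq_inner[of "J z"] cmod_power2)
  then show ?thesis by simp
qed

lemma omult_J: "(t, - \<sigma> *\<^sub>R w) \<odot> J z = J ((complex_of_real t - \<i> * complex_of_real \<sigma>) * z)"
proof -
  have "(t, - \<sigma> *\<^sub>R w) = t *\<^sub>R oone - \<sigma> *\<^sub>R (0, w)"
    by (simp add: oone_def)
  then have "(t, - \<sigma> *\<^sub>R w) \<odot> J z = t *\<^sub>R J z - \<sigma> *\<^sub>R ((0, w) \<odot> J z)"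
    by (simp only: omult.diff_left omult.scaleR_left oone_omult)
  also have "(0, w) \<odot> J z = Re z *\<^sub>R a - Im z *\<^sub>R b"
    unfolding J_def omult.add_right omult.scaleR_right wa wb by simp
  finally show ?thesis
    by (simp add: J_def algebra_simps)
qed

lemma inj_L: "inj L"
  using norm_L by (subst linear_injective_0[OF lin_L]) (metis norm_eq_zero)

lemma surj_L: "surj L"
proof -
  have "dim (range L) = dim (UNIV :: (real \<times> (real ^ 6)) set)"
    by (rule dim_image_eq[OF lin_L]) (use inj_L in simp)
  then have "dim (range L) = DIM(real ^ 7)" by simp
  then have "span (range L) = UNIV" using dim_eq_full by blast
  moreover have "span (range L) = range L"
    using lin_L by (intro span_eq_iff[THEN iffD2] linear_subspace_image) simp_all
  ultimately show ?thesis by simp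
qed

definition M :: "real ^ 7 \<Rightarrow> real \<times> (real ^ 6)" where "M = inv L"

lemma M_L [simp]: "M (L x) = x" and L_M [simp]: "L (M u) = u"
  using inj_L surj_L by (simp_all add: M_def surj_f_inv_f)

lemma linear_M: "linear M"
proof (rule linearI)
  show "M (u + v) = M u + M v" for u v
    using linear_add[OF lin_L, of "M u" "M v"] by (metis L_M M_L)
  show "M (r *\<^sub>R u) = r *\<^sub>R M u" for r u
    using linear_scale[OF lin_L, of r "M u"] by (metis L_M M_L)
qed

lemma continuous_on_L: "continuous_on S L" and continuous_on_M: "continuous_on T M"
  using lin_L linear_M by (auto simp: linear_continuous_on linear_linear)

lemma L_measurable [measurable]: "L \<in> borel_measurable borel"
  and M_measurable [measurable]: "M \<in> borel_measurable borel"
  by (auto intro!: borel_measurable_continuous_onI continuous_on_L continuous_on_M)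

lemma integral_L:
  fixes G :: "real ^ 7 \<Rightarrow> 'z::{banach, second_countable_topology}"
  assumes [measurable]: "G \<in> borel_measurable borel"
  shows "(LINT u|lebesgue. G u) = (LINT x|lborel. G (L x))"
    and "integrable lebesgue G \<longleftrightarrow> integrable lborel (\<lambda>x. G (L x))"
proof -
  have "(LINT u|lebesgue. G u) = (LINT u|distr lborel borel L. G u)"
    by (simp add: integral_completion L_lborel)
  then show "(LINT u|lebesgue. G u) = (LINT x|lborel. G (L x))"
    by (simp add: integral_distr)
  have "integrable lebesgue G \<longleftrightarrow> integrable (distr lborel borel L) G"
    by (simp add: integrable_completion L_lborel)
  then show "integrable lebesgue G \<longleftrightarrow> integrable lborel (\<lambda>x. G (L x))"
    by (simp add: integrable_distr_eq)
qed

text \<open>The dipole along \<open>w\<close>, cut off transversally to become square integrable on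
  R^7. The values stay in the real span of \<open>a\<close> and \<open>b\<close>, hence in any
  subspace containing both.\<close>

definition wave :: "real \<Rightarrow> real ^ 7 \<Rightarrow> octonion" where
  "wave \<tau> u = bump (snd (M u)) *\<^sub>R J (dipole \<tau> (fst (M u)))"

lemma continuous_on_wave: "\<tau> > 0 \<Longrightarrow> continuous_on S (wave \<tau>)"
  unfolding wave_def
  by (intro continuous_intros continuous_on_compose2[OF continuous_on_bump[of UNIV]]
      bounded_linear.continuous_on[OF bounded_linear_J]
      continuous_on_compose2[OF continuous_on_dipole[of _ UNIV]] continuous_on_M) auto

lemma wave_measurable: "\<tau> > 0 \<Longrightarrow> wave \<tau> \<in> borel_measurable borel"
  by (intro borel_measurable_continuous_onI continuous_on_wave)

lemma wave_square:
  "norm (wave \<tau> (L x)) powr 2 = 1 / (\<tau>\<^sup>2 + (norm (fst x))\<^sup>2) ^ 2 * (bump (snd x))\<^sup>2"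
  by (simp add: wave_def norm_J norm_dipole power_mult_distrib power_divide)

lemma wave_integral:
  assumes "\<tau> > 0"
  shows "integrable lebesgue (\<lambda>u. norm (wave \<tau> u) powr 2)"
    and "(LINT u|lebesgue. norm (wave \<tau> u) powr 2)
      = (LINT s|lborel. 1 / (1 + (norm (s :: real))\<^sup>2) ^ 2) * (LINT y|lborel. (bump (y :: real ^ 6))\<^sup>2) / \<tau> ^ 3"
proof -
  have meas: "(\<lambda>u. norm (wave \<tau> u) powr 2) \<in> borel_measurable borel"
    using wave_measurable[OF assms] by measurable
  have int: "integrable lborel (\<lambda>s :: real. 1 / (\<tau>\<^sup>2 + (norm s)\<^sup>2) ^ 2)"
    using assms by (intro integrable_japanese_bracket) auto
  note prod = integrable_lborel_product[OF int integrable_bump_square[where 'a = "real ^ 6"]]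
  show "integrable lebesgue (\<lambda>u. norm (wave \<tau> u) powr 2)"
    using prod(1) unfolding integral_L(2)[OF meas] wave_square .
  have "\<tau> / \<tau> ^ 4 = 1 / \<tau> ^ 3" using assms by (simp add: eval_nat_numeral)
  then show "(LINT u|lebesgue. norm (wave \<tau> u) powr 2)
      = (LINT s|lborel. 1 / (1 + (norm (s :: real))\<^sup>2) ^ 2) * (LINT y|lborel. (bump (y :: real ^ 6))\<^sup>2) / \<tau> ^ 3"
    unfolding integral_L(1)[OF meas] wave_square prod(2)
      integral_japanese_bracket_scale[OF assms, of 2, where 'a = real] by simp
qed

section \<open>The Cauchy integral of the wave\<close>

definition kern :: "real \<Rightarrow> real \<times> (real ^ 6) \<Rightarrow> octonion" where
  "kern t p = cauchy_kernel (t, L p)"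

lemma norm_L_pair: "norm (t :: real, L p) = norm (t, p)"
  by (simp add: norm_prod_def[of "(t, L p)"] norm_prod_def[of "(t, p)"] norm_L)

lemma norm_kern: "norm (kern t p) = 1 / norm (t, p) ^ 7"
  by (simp add: kern_def norm_cauchy_kernel norm_L_pair)

lemma continuous_on_kern: "t > 0 \<Longrightarrow> continuous_on S (kern t)"
  unfolding kern_def cauchy_kernel_def norm_L_pair
  by (intro continuous_intros bounded_linear.continuous_on[OF bounded_linear_ocnj] continuous_on_L)
     (auto simp: zero_prod_def)

text \<open>The first summand acts on the plane of \<open>J\<close> as the complex number t - i
  sigma; the second is odd in \<open>v\<close> and disappears on integration.\<close>

lemma kern_decomp:
  "kern t (\<sigma>, v) = (1 / (t\<^sup>2 + \<sigma>\<^sup>2 + (norm v)\<^sup>2) ^ 4) *\<^sub>R (t, - \<sigma> *\<^sub>R w)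
    + (1 / (t\<^sup>2 + \<sigma>\<^sup>2 + (norm v)\<^sup>2) ^ 4) *\<^sub>R (0, - L (0, v))"
proof -
  have "norm (t, \<sigma>, v) ^ 8 = ((norm (t, \<sigma>, v))\<^sup>2) ^ 4"
    by (simp flip: power_mult)
  also have "(norm (t, \<sigma>, v))\<^sup>2 = t\<^sup>2 + \<sigma>\<^sup>2 + (norm v)\<^sup>2"
    by (simp add: norm_prod_def)
  finally have n: "norm (t, \<sigma>, v) ^ 8 = (t\<^sup>2 + \<sigma>\<^sup>2 + (norm v)\<^sup>2) ^ 4" .
  have "L (\<sigma>, v) = L (\<sigma> *\<^sub>R (1, 0) + (0, v))" by simp
  also have "\<dots> = \<sigma> *\<^sub>R w + L (0, v)"
    by (simp only: linear_add[OF lin_L] linear_scale[OF lin_L] L_axis)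
  finally have "ocnj (t, L (\<sigma>, v)) = (t, - \<sigma> *\<^sub>R w) + (0, - L (0, v))"
    by (simp add: ocnj_def)
  then show ?thesis
    unfolding kern_def cauchy_kernel_def norm_L_pair n by (simp only: scaleR_add_right)
qed

lemma integrable_kern_dipole:
  assumes t: "t > 0" and \<tau>: "\<tau> > 0"
    and g: "continuous_on UNIV g" "\<And>p. \<bar>g p\<bar> \<le> 1"
  shows "integrable lborel (\<lambda>p. kern t p \<odot> (g p *\<^sub>R J (dipole \<tau> (s - fst p))))"
proof (rule Bochner_Integration.integrable_bound)
  show "integrable lborel (\<lambda>p :: real \<times> (real ^ 6). 1 / norm (t, p) ^ 7 * norm (dipole \<tau> (s - fst p)))"
    using integrable_kernel_dipole[OF t \<tau>, where 'a = "real ^ 6"] by simp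
  show "AE p in lborel. norm (kern t p \<odot> (g p *\<^sub>R J (dipole \<tau> (s - fst p))))
      \<le> norm (1 / norm (t, p) ^ 7 * norm (dipole \<tau> (s - fst p)))"
  proof (intro AE_I2)
    fix p
    have "norm (kern t p \<odot> (g p *\<^sub>R J (dipole \<tau> (s - fst p))))
        = \<bar>g p\<bar> * (1 / norm (t, p) ^ 7 * norm (dipole \<tau> (s - fst p)))"
      by (simp add: norm_omult norm_kern norm_J)
    also have "\<dots> \<le> 1 * (1 / norm (t, p) ^ 7 * norm (dipole \<tau> (s - fst p)))"
      by (intro mult_right_mono g) simp
    finally show "norm (kern t p \<odot> (g p *\<^sub>R J (dipole \<tau> (s - fst p))))
        \<le> norm (1 / norm (t, p) ^ 7 * norm (dipole \<tau> (s - fst p)))" by simp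
  qed
  have "continuous_on UNIV (\<lambda>p. kern t p \<odot> (g p *\<^sub>R J (dipole \<tau> (s - fst p))))"
    by (intro omult.continuous_on continuous_on_kern t continuous_intros g
        bounded_linear.continuous_on[OF bounded_linear_J]
        continuous_on_compose2[OF continuous_on_dipole[OF \<tau>, of UNIV]]) auto
  then show "(\<lambda>p. kern t p \<odot> (g p *\<^sub>R J (dipole \<tau> (s - fst p)))) \<in> borel_measurable lborel"
    by (simp add: borel_measurable_continuous_onI)
qed

text \<open>Fubini with the transverse integral inside: what remains is \<open>J\<close> of a
  multiple of the dipole against 1 / (t + i sigma), and the contour integral vanishes.\<close>

lemma integral_kern_dipole_eq_0:
  assumes t: "t > 0" and \<tau>: "\<tau> > 0"
  shows "(LINT p|lborel. kern t p \<odot> J (dipole \<tau> (s - fst p))) = 0"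
proof -
  define F where "F p = kern t p \<odot> J (dipole \<tau> (s - fst p))" for p
  define B where "B = (LINT v|lborel. 1 / (1 + (norm (v :: real ^ 6))\<^sup>2) ^ 4)"
  have "integrable lborel F"
    using integrable_kern_dipole[OF t \<tau>, of "\<lambda>_. 1" s] by (simp add: F_def[abs_def])
  then have F_int: "integrable (lborel \<Otimes>\<^sub>M lborel) F"
    by (simp add: lborel_prod)
  \<comment> \<open>Claimed on integrable slices only; Fubini provides these for almost every
    \<open>\<sigma>\<close>.\<close>
  have inner_eq: "(LINT v|lborel. F (\<sigma>, v))
      = J (complex_of_real B * (dipole \<tau> (s - \<sigma>) / (complex_of_real t + \<i> * complex_of_real \<sigma>)))"
    if int: "integrable lborel (\<lambda>v. F (\<sigma>, v))" for \<sigma>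
  proof -
    define r where "r = sqrt (t\<^sup>2 + \<sigma>\<^sup>2)"
    have r: "r > 0" "r\<^sup>2 = t\<^sup>2 + \<sigma>\<^sup>2"
      using t by (simp_all add: r_def add_pos_nonneg)
    let ?d = "dipole \<tau> (s - \<sigma>)"
    let ?q = "\<lambda>v :: real ^ 6. 1 / (r\<^sup>2 + (norm v)\<^sup>2) ^ 4"
    define F1 where "F1 = (\<lambda>v. ?q v *\<^sub>R ((t, - \<sigma> *\<^sub>R w) \<odot> J ?d))"
    define F2 where "F2 = (\<lambda>v. ?q v *\<^sub>R ((0, - L (0, v)) \<odot> J ?d))"
    have F12: "F (\<sigma>, v) = F1 v + F2 v" for v
      unfolding F_def kern_decomp F1_def F2_def r(2) fst_conv omult.add_left omult.scaleR_left ..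
    have q_int: "integrable lborel ?q"
      by (rule integrable_japanese_bracket[OF r(1)]) simp
    then have F1_int: "integrable lborel F1"
      unfolding F1_def by (intro integrable_scaleR_left)
    have "(\<lambda>v. F (\<sigma>, v) - F1 v) = F2" by (simp add: F12)
    with Bochner_Integration.integrable_diff[OF int F1_int] have F2_int: "integrable lborel F2" by simp
    \<comment> \<open>Reflection of \<open>v\<close> changes the sign of the integrand, so the
      integral equals its own negative.\<close>
    have "(LINT v|lborel. F2 v) = (LINT v|lborel. F2 (0 - v))"
      using F2_int by (intro integral_lborel_reflect) auto
    also have "\<dots> = (LINT v|lborel. - F2 v)"
    proof -
      have "L (0, - v) = - L (0, v)" for v
        using linear_neg[OF lin_L, of "(0, v)"] by simp
      then have "F2 (0 - v) = - F2 v" for v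
        by (simp add: F2_def omult.minus_left flip: scaleR_minus_right) (simp flip: omult.minus_left)
      then show ?thesis by simp
    qed
    finally have "(LINT v|lborel. F2 v) = - (LINT v|lborel. F2 v)" by simp
    then have "(LINT v|lborel. F2 v) + (LINT v|lborel. F2 v) = 0"
      by (metis add.right_inverse)
    then have F2_0: "(LINT v|lborel. F2 v) = 0"
      by (simp flip: scaleR_2)
    have "(LINT v|lborel. F (\<sigma>, v)) = (LINT v|lborel. F1 v)"
      unfolding F12 using F1_int F2_int F2_0 by simp
    also have "\<dots> = (LINT v|lborel. ?q v) *\<^sub>R ((t, - \<sigma> *\<^sub>R w) \<odot> J ?d)"
      unfolding F1_def using q_int by simp
    also have "(LINT v|lborel. ?q v) = B / r\<^sup>2"
    proof -
      have "r ^ 6 / r ^ 8 = 1 / r\<^sup>2" using r(1) by (simp add: divide_simps flip: power_add)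
      then show ?thesis
        unfolding integral_japanese_bracket_scale[OF r(1)] by (simp add: B_def)
    qed
    also have "(B / r\<^sup>2) *\<^sub>R ((t, - \<sigma> *\<^sub>R w) \<odot> J ?d)
        = J ((B / r\<^sup>2) *\<^sub>R ((complex_of_real t - \<i> * complex_of_real \<sigma>) * ?d))"
      by (simp only: omult_J linear_simps(5)[OF bounded_linear_J])
    \<comment> \<open>Here \<open>r\<^sup>2\<close> is the product of t + i sigma and its conjugate;
      the exponent 2 is 8 - 6, from scaling in R^6.\<close>
    also have "(B / r\<^sup>2) *\<^sub>R ((complex_of_real t - \<i> * complex_of_real \<sigma>) * ?d)
        = complex_of_real B * (?d / (complex_of_real t + \<i> * complex_of_real \<sigma>))"
    proof -
      have ne: "complex_of_real t + \<i> * complex_of_real \<sigma> \<noteq> 0" using t by (simp add: complex_eq_iff)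
      have "(complex_of_real t - \<i> * complex_of_real \<sigma>) * (complex_of_real t + \<i> * complex_of_real \<sigma>) = complex_of_real (r\<^sup>2)"
        unfolding r(2) by (simp add: complex_eq_iff power2_eq_square)
      then have "(complex_of_real t - \<i> * complex_of_real \<sigma>) / complex_of_real (r\<^sup>2) = 1 / (complex_of_real t + \<i> * complex_of_real \<sigma>)"
        using ne r(1) by (simp add: field_simps)
      then have "complex_of_real B * ?d * ((complex_of_real t - \<i> * complex_of_real \<sigma>) / complex_of_real (r\<^sup>2))
          = complex_of_real B * ?d * (1 / (complex_of_real t + \<i> * complex_of_real \<sigma>))" by simp
      then show ?thesis by (simp add: scaleR_conv_of_real mult_ac)
    qed
    finally show ?thesis .
  qed
  have rhs_int: "integrable lborel (\<lambda>\<sigma>. complex_of_real B * (dipole \<tau> (s - \<sigma>) / (complex_of_real t + \<i> * complex_of_real \<sigma>)))"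
    by (intro integrable_mult_right integrable_dipole_quotient t \<tau>)
  have "(LINT p|lborel. F p) = (LINT \<sigma>|lborel. LINT v|lborel. F (\<sigma>, v))"
    using lborel_pair.integral_fst'[OF F_int] by (simp add: lborel_prod)
  also have "\<dots> = (LINT \<sigma>|lborel. J (complex_of_real B * (dipole \<tau> (s - \<sigma>) / (complex_of_real t + \<i> * complex_of_real \<sigma>))))"
  proof (rule integral_cong_AE)
    show "(\<lambda>\<sigma>. LINT v|lborel. F (\<sigma>, v)) \<in> borel_measurable lborel"
      using lborel_pair.integrable_fst'[OF F_int] by auto
    show "(\<lambda>\<sigma>. J (complex_of_real B * (dipole \<tau> (s - \<sigma>) / (complex_of_real t + \<i> * complex_of_real \<sigma>)))) \<in> borel_measurable lborel"
      using integrable_bounded_linear[OF bounded_linear_J rhs_int] by auto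
    show "AE \<sigma> in lborel. (LINT v|lborel. F (\<sigma>, v))
        = J (complex_of_real B * (dipole \<tau> (s - \<sigma>) / (complex_of_real t + \<i> * complex_of_real \<sigma>)))"
      using lborel_pair.AE_integrable_fst'[OF F_int] by eventually_elim (rule inner_eq)
  qed
  also have "\<dots> = J (LINT \<sigma>|lborel. complex_of_real B * (dipole \<tau> (s - \<sigma>) / (complex_of_real t + \<i> * complex_of_real \<sigma>)))"
    by (rule integral_bounded_linear[OF bounded_linear_J rhs_int])
  also have "\<dots> = 0"
    using integral_dipole_eq_0[OF t \<tau>, of s] by (simp only: integral_mult_right_zero mult_zero_right) (simp add: J_def)
  finally show ?thesis by (simp add: F_def)
qed

text \<open>Subtract \<open>bump (snd x)\<close>, constant in the integration variable, times the
  vanishing integral of the uncut dipole. Only the increment of the cut-off remains, and it tames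
  the kernel at small transverse distance.\<close>

lemma cauchy_integral_wave:
  assumes t: "t > 0" and \<tau>: "\<tau> > 0"
  shows "cauchy_integral (wave \<tau>) (t, L x) = (1 / omega8) *\<^sub>R
    (LINT p|lborel. kern t p \<odot> ((bump (snd x - snd p) - bump (snd x)) *\<^sub>R J (dipole \<tau> (fst x - fst p))))"
proof -
  let ?d = "\<lambda>p. J (dipole \<tau> (fst x - fst p))"
  define G where "G u = cauchy_kernel ((t, L x) - (0, u)) \<odot> wave \<tau> u" for u
  have "continuous_on UNIV (\<lambda>u. cauchy_kernel ((t, L x) - (0, u)))"
    unfolding cauchy_kernel_def using t
    by (intro continuous_intros bounded_linear.continuous_on[OF bounded_linear_ocnj]) (auto simp: zero_prod_def)
  then have "continuous_on UNIV G"
    unfolding G_def by (intro omult.continuous_on continuous_on_wave \<tau>)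
  then have G_meas: "G \<in> borel_measurable borel" by (rule borel_measurable_continuous_onI)
  have "(LINT u|lebesgue. G u) = (LINT p|lborel. G (L p))"
    by (rule integral_L[OF G_meas])
  also have "\<dots> = (LINT p|lborel. G (L (x - p)))"
    by (rule integral_lborel_reflect) (rule measurable_compose[OF L_measurable G_meas])
  also have "\<dots> = (LINT p|lborel. kern t p \<odot> (bump (snd x - snd p) *\<^sub>R ?d p))"
  proof -
    have "L x - L (x - p) = L p" for p
      by (simp add: linear_diff[OF lin_L])
    then show ?thesis by (simp add: G_def wave_def kern_def)
  qed
  also have "\<dots> = (LINT p|lborel. kern t p \<odot> (bump (snd x - snd p) *\<^sub>R ?d p)) -
      (LINT p|lborel. kern t p \<odot> (bump (snd x) *\<^sub>R ?d p))"
    using integral_kern_dipole_eq_0[OF t \<tau>, of "fst x"] by (simp add: omult.scaleR_right)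
  also have "\<dots> = (LINT p|lborel. kern t p \<odot> (bump (snd x - snd p) *\<^sub>R ?d p) - kern t p \<odot> (bump (snd x) *\<^sub>R ?d p))"
  proof (rule Bochner_Integration.integral_diff[symmetric])
    show "integrable lborel (\<lambda>p. kern t p \<odot> (bump (snd x - snd p) *\<^sub>R ?d p))"
      by (intro integrable_kern_dipole t \<tau> continuous_intros abs_bump_le_1
          continuous_on_compose2[OF continuous_on_bump[of UNIV]]) auto
    show "integrable lborel (\<lambda>p. kern t p \<odot> (bump (snd x) *\<^sub>R ?d p))"
      by (intro integrable_kern_dipole t \<tau> continuous_intros abs_bump_le_1)
  qed
  finally show ?thesis
    by (simp add: cauchy_integral_kernel G_def omult.diff_right[symmetric] scaleR_diff_left)
qed

lemma norm_cauchy_integral_wave_le: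
  assumes t: "t > 0" and \<tau>: "\<tau> > 0"
  shows "ennreal (norm (cauchy_integral (wave \<tau>) (t, L x))) \<le> ennreal \<bar>1 / omega8\<bar> *
    (\<integral>\<^sup>+p. ennreal (1 / norm (t, p) ^ 7 * \<bar>bump (snd x - snd p) - bump (snd x)\<bar>
        * (1 / (\<tau>\<^sup>2 + (fst x - fst p)\<^sup>2))) \<partial>lborel)"
proof -
  let ?h = "\<lambda>p. kern t p \<odot> ((bump (snd x - snd p) - bump (snd x)) *\<^sub>R J (dipole \<tau> (fst x - fst p)))"
  have "integrable lborel ?h"
    using bump_diff_le[of "snd x"]
    by (intro integrable_kern_dipole t \<tau> continuous_intros continuous_on_compose2[OF continuous_on_bump[of UNIV]])
       (auto intro: order_trans)
  then have "ennreal (norm (LINT p|lborel. ?h p)) \<le> (\<integral>\<^sup>+p. ennreal (norm (?h p)) \<partial>lborel)"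
    by (rule integral_norm_bound_ennreal)
  moreover have "norm (?h p) = 1 / norm (t, p) ^ 7 * \<bar>bump (snd x - snd p) - bump (snd x)\<bar>
        * (1 / (\<tau>\<^sup>2 + (fst x - fst p)\<^sup>2))" for p
    by (simp add: norm_omult norm_kern norm_J norm_dipole)
  ultimately have le: "ennreal (norm (LINT p|lborel. ?h p)) \<le> (\<integral>\<^sup>+p. ennreal (1 / norm (t, p) ^ 7
      * \<bar>bump (snd x - snd p) - bump (snd x)\<bar> * (1 / (\<tau>\<^sup>2 + (fst x - fst p)\<^sup>2))) \<partial>lborel)"
    by (simp only:)
  have "ennreal (norm (cauchy_integral (wave \<tau>) (t, L x))) = ennreal \<bar>1 / omega8\<bar> * ennreal (norm (LINT p|lborel. ?h p))"
    unfolding cauchy_integral_wave[OF t \<tau>] norm_scaleR by (rule ennreal_mult) simp_all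
  then show ?thesis
    using mult_left_mono[OF le, of "ennreal \<bar>1 / omega8\<bar>"] by (simp only: zero_le)
qed

text \<open>The square integral is transported from R^7 by the measure-preserving \<open>L\<close>
  and bounded by the remainder estimate. The constant is the same for all heights, so the bound
  passes to the Hardy norm.\<close>

lemma Lp_norm_cauchy_integral_wave_le:
  obtains C where "C \<ge> 0"
    "\<And>t \<tau>. t > 0 \<Longrightarrow> \<tau> > 0 \<Longrightarrow> Lp_norm 2 (\<lambda>u. cauchy_integral (wave \<tau>) (t, u)) \<le> C / \<tau>"
proof -
  show thesis
  proof (rule singular_remainder_estimate)
    fix S :: "real \<Rightarrow> real \<Rightarrow> real \<times> (real ^ 6) \<Rightarrow> ennreal" and C :: real
    assume S_meas: "\<And>t \<tau>. S t \<tau> \<in> borel_measurable borel"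
      and S_le: "\<And>t \<tau> x. \<tau> > 0 \<Longrightarrow> t > 0 \<Longrightarrow>
        (\<integral>\<^sup>+w. ennreal (1 / norm (t, w) ^ 7 * \<bar>bump (snd x - snd w) - bump (snd x)\<bar>
          * (1 / (\<tau>\<^sup>2 + (fst x - fst w)\<^sup>2))) \<partial>lborel)\<^sup>2 \<le> S t \<tau> x"
      and S_int: "\<And>t \<tau>. \<tau> > 0 \<Longrightarrow> t > 0 \<Longrightarrow> (\<integral>\<^sup>+x. S t \<tau> x \<partial>lborel) \<le> ennreal (C / \<tau>\<^sup>2)"
      and C: "C \<ge> 0"
    define c where "c = \<bar>1 / omega8\<bar>"
    have c: "c \<ge> 0" by (simp add: c_def)
    have "Lp_norm 2 (\<lambda>u. cauchy_integral (wave \<tau>) (t, u)) \<le> (c * sqrt C) / \<tau>"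
      if t: "t > 0" and \<tau>: "\<tau> > 0" for t \<tau> :: real
    proof -
      let ?f = "\<lambda>u. norm (cauchy_integral (wave \<tau>) (t, u)) powr 2"
      have pw: "ennreal (?f u) \<le> ennreal (c\<^sup>2) * S t \<tau> (M u)" for u
      proof -
        let ?I = "\<integral>\<^sup>+p. ennreal (1 / norm (t, p) ^ 7 * \<bar>bump (snd (M u) - snd p) - bump (snd (M u))\<bar>
          * (1 / (\<tau>\<^sup>2 + (fst (M u) - fst p)\<^sup>2))) \<partial>lborel"
        have "ennreal (norm (cauchy_integral (wave \<tau>) (t, u))) \<le> ennreal c * ?I"
          using norm_cauchy_integral_wave_le[OF t \<tau>, of "M u"] by (simp add: c_def)
        then have "(ennreal (norm (cauchy_integral (wave \<tau>) (t, u))))\<^sup>2 \<le> (ennreal c * ?I)\<^sup>2"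
          by (rule power_mono) simp
        also have "\<dots> = ennreal (c\<^sup>2) * ?I\<^sup>2"
          using c by (simp add: power_mult_distrib ennreal_power)
        also have "\<dots> \<le> ennreal (c\<^sup>2) * S t \<tau> (M u)"
          by (intro mult_left_mono S_le t \<tau>) simp
        finally show ?thesis by (simp add: ennreal_power)
      qed
      have "(\<integral>\<^sup>+u. ennreal (?f u) \<partial>lebesgue) \<le> (\<integral>\<^sup>+u. ennreal (c\<^sup>2) * S t \<tau> (M u) \<partial>lborel)"
        unfolding nn_integral_completion by (intro nn_integral_mono pw)
      also have "\<dots> = (\<integral>\<^sup>+u. ennreal (c\<^sup>2) * S t \<tau> (M u) \<partial>distr lborel borel L)"
        by (simp only: L_lborel)
      also have "\<dots> = (\<integral>\<^sup>+x. ennreal (c\<^sup>2) * S t \<tau> x \<partial>lborel)"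
        using measurable_compose[OF M_measurable S_meas[of t \<tau>]] by (subst nn_integral_distr) auto
      also have "\<dots> \<le> ennreal (c\<^sup>2) * ennreal (C / \<tau>\<^sup>2)"
        using S_meas[of t \<tau>] S_int[OF \<tau> t] by (subst nn_integral_cmult) (auto intro: mult_left_mono)
      also have "\<dots> = ennreal (c\<^sup>2 * (C / \<tau>\<^sup>2))"
        using C by (simp flip: ennreal_mult)
      finally have nn: "(\<integral>\<^sup>+u. ennreal (?f u) \<partial>lebesgue) \<le> ennreal (c\<^sup>2 * (C / \<tau>\<^sup>2))" .
      have "(LINT u|lebesgue. ?f u) \<le> c\<^sup>2 * (C / \<tau>\<^sup>2)"
      proof (cases "integrable lebesgue ?f")
        case True
        have "ennreal (LINT u|lebesgue. ?f u) = (\<integral>\<^sup>+u. ennreal (?f u) \<partial>lebesgue)"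
          using nn_integral_eq_integral[OF True] by simp
        with nn have "ennreal (LINT u|lebesgue. ?f u) \<le> ennreal (c\<^sup>2 * (C / \<tau>\<^sup>2))"
          by (simp only:)
        moreover have "0 \<le> c\<^sup>2 * (C / \<tau>\<^sup>2)" using C by simp
        ultimately show ?thesis by (simp only: ennreal_le_iff)
      next
        \<comment> \<open>The integral takes its default value 0, below the nonnegative
          bound.\<close>
        case False
        then show ?thesis using C by (simp add: not_integrable_integral_eq)
      qed
      then have "Lp_norm 2 (\<lambda>u. cauchy_integral (wave \<tau>) (t, u)) \<le> (c\<^sup>2 * (C / \<tau>\<^sup>2)) powr (1 / 2)"
        unfolding Lp_norm_def by (intro powr_mono2) (auto intro!: Bochner_Integration.integral_nonneg)
      also have "\<dots> = c * sqrt C / \<tau>"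
        using c C \<tau> by (simp add: powr_half_sqrt real_sqrt_mult real_sqrt_divide)
      finally show ?thesis .
    qed
    then show thesis
      using c C by (intro that[of "c * sqrt C"]) auto
  qed
qed

text \<open>A lower bound would give sqrt(A / tau^3) <= K C / tau, that is A <= (K C)^2 tau for all
  positive tau, although A is positive.\<close>

lemma cauchy_integral_not_bounded_below:
  "\<not> (\<exists>K. \<forall>\<tau>>0. Lp_norm 2 (wave \<tau>) \<le> K * Hp_norm 2 (cauchy_integral (wave \<tau>)))"
proof
  assume "\<exists>K. \<forall>\<tau>>0. Lp_norm 2 (wave \<tau>) \<le> K * Hp_norm 2 (cauchy_integral (wave \<tau>))"
  then obtain K0 where K0: "\<And>\<tau>. \<tau> > 0 \<Longrightarrow> Lp_norm 2 (wave \<tau>) \<le> K0 * Hp_norm 2 (cauchy_integral (wave \<tau>))"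
    by blast
  obtain C where C: "C \<ge> 0"
    "\<And>t \<tau>. t > 0 \<Longrightarrow> \<tau> > 0 \<Longrightarrow> Lp_norm 2 (\<lambda>u. cauchy_integral (wave \<tau>) (t, u)) \<le> C / \<tau>"
    using Lp_norm_cauchy_integral_wave_le by blast
  define K where "K = \<bar>K0\<bar>"
  define A where "A = (LINT s|lborel. 1 / (1 + (norm (s :: real))\<^sup>2) ^ 2) * (LINT y|lborel. (bump (y :: real ^ 6))\<^sup>2)"
  have A: "A > 0"
    unfolding A_def by (intro mult_pos_pos integral_japanese_bracket_pos integral_bump_square_pos) simp
  have upper: "Hp_norm 2 (cauchy_integral (wave \<tau>)) \<le> C / \<tau>" "Hp_norm 2 (cauchy_integral (wave \<tau>)) \<ge> 0"
    if \<tau>: "\<tau> > 0" for \<tau>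
  proof -
    show "Hp_norm 2 (cauchy_integral (wave \<tau>)) \<le> C / \<tau>"
      unfolding Hp_norm_def using C(2) \<tau> by (intro cSUP_least) auto
    \<comment> \<open>Boundedness guarantees that the supremum dominates each of its terms, which
      are nonnegative.\<close>
    have "bdd_above ((\<lambda>t. Lp_norm 2 (\<lambda>x. cauchy_integral (wave \<tau>) (t, x))) ` {0<..})"
      using C(2) \<tau> by (intro bdd_aboveI2) simp
    then show "Hp_norm 2 (cauchy_integral (wave \<tau>)) \<ge> 0"
      unfolding Hp_norm_def by (intro cSUP_upper2[of _ _ 1]) (auto simp: Lp_norm_def)
  qed
  have "A \<le> (K * C)\<^sup>2 * \<tau>" if \<tau>: "\<tau> > 0" for \<tau>
  proof -
    have "Lp_norm 2 (wave \<tau>) = sqrt (A / \<tau> ^ 3)"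
      unfolding Lp_norm_def wave_integral(2)[OF \<tau>] A_def[symmetric]
      using A \<tau> by (intro powr_half_sqrt) simp
    also have "sqrt (A / \<tau> ^ 3) \<le> K * (C / \<tau>)"
    proof -
      have "K0 * Hp_norm 2 (cauchy_integral (wave \<tau>)) \<le> K * (C / \<tau>)"
        using upper[OF \<tau>] by (intro mult_mono) (auto simp: K_def)
      with K0[OF \<tau>] show ?thesis unfolding calculation by (rule order_trans)
    qed
    finally have "sqrt (A / \<tau> ^ 3) \<le> K * (C / \<tau>)"
      using \<open>sqrt (A / \<tau> ^ 3) \<le> K * (C / \<tau>)\<close> by simp
    then have "(sqrt (A / \<tau> ^ 3))\<^sup>2 \<le> (K * (C / \<tau>))\<^sup>2"
      using A \<tau> by (intro power_mono) auto
    then show ?thesis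
      using A \<tau> by (simp add: field_simps power2_eq_square power3_eq_cube)
  qed
  \<comment> \<open>This small tau brings the right side down to at most A / 2; the added 1 covers
    the case K C = 0.\<close>
  from this[of "A / (2 * ((K * C)\<^sup>2 + 1))"] A
  have "A \<le> (K * C)\<^sup>2 * (A / (2 * ((K * C)\<^sup>2 + 1)))"
    by (simp add: add_nonneg_pos)
  also have "\<dots> = A / 2 * ((K * C)\<^sup>2 / ((K * C)\<^sup>2 + 1))"
    by simp
  also have "\<dots> \<le> A / 2 * 1"
    using A by (intro mult_left_mono) (auto simp: divide_le_eq_1 add_nonneg_pos)
  finally show False using A by simp
qed

lemma wave_in_Lp_space:
  assumes "subspace H" "a \<in> H" "b \<in> H" "\<tau> > 0"
  shows "wave \<tau> \<in> Lp_space 2 H"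
  using assms wave_integral(1)[OF assms(4)] wave_measurable[OF assms(4)]
  by (auto simp: measurable_completion Lp_space_def wave_def J_def subspace_add subspace_scale)

end

section \<open>Both cases refuted at the exponent 2\<close>

theorem theorem1p5:
  "\<not> (\<exists>H0 H1 :: octonion set.
        subspace H0 \<and> H0 \<noteq> UNIV \<and> subspace H1 \<and> H1 \<noteq> UNIV \<and>
        direct_sum H0 H1 \<and>
        (\<forall>p::real. 1 < p \<longrightarrow>
           normed_isomorphism (Lp_space p H0) ae_equal (Lp_norm p)
             (Hp_space p) half_equal (Hp_norm p) cauchy_integral) \<and>
        (\<forall>p::real. 1 < p \<longrightarrow>
           continuous_onto (Hp_space p) (Hp_norm p)
             (Lp_space p H0) ae_equal (Lp_norm p)
             (\<lambda>F x. Tan H0 H1 (boundary_value F x))))"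
proof
  assume "\<exists>H0 H1 :: octonion set.
        subspace H0 \<and> H0 \<noteq> UNIV \<and> subspace H1 \<and> H1 \<noteq> UNIV \<and>
        direct_sum H0 H1 \<and>
        (\<forall>p::real. 1 < p \<longrightarrow>
           normed_isomorphism (Lp_space p H0) ae_equal (Lp_norm p)
             (Hp_space p) half_equal (Hp_norm p) cauchy_integral) \<and>
        (\<forall>p::real. 1 < p \<longrightarrow>
           continuous_onto (Hp_space p) (Hp_norm p)
             (Lp_space p H0) ae_equal (Lp_norm p)
             (\<lambda>F x. Tan H0 H1 (boundary_value F x)))"
  then obtain H0 :: "octonion set" where H0: "subspace H0"
    and iso: "\<forall>p::real. 1 < p \<longrightarrow> normed_isomorphism (Lp_space p H0) ae_equal (Lp_norm p)
             (Hp_space p) half_equal (Hp_norm p) cauchy_integral"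
    by blast
  have iso2: "normed_isomorphism (Lp_space 2 H0) ae_equal (Lp_norm 2)
             (Hp_space 2) half_equal (Hp_norm 2) cauchy_integral"
    using iso by simp
  have onto: "\<And>F. F \<in> Hp_space 2 \<Longrightarrow> \<exists>f\<in>Lp_space 2 H0. half_equal (cauchy_integral f) F"
    and below: "\<exists>K. \<forall>f\<in>Lp_space 2 H0. Lp_norm 2 f \<le> K * Hp_norm 2 (cauchy_integral f)"
    using iso2 unfolding normed_isomorphism_def by blast+
  from H0 show False
  proof (cases rule: subspace_orthonormal_pair_or_line)
    case (pair a b)
    obtain w where w: "norm w = 1" "(0, w) \<odot> b = a" "(0, w) \<odot> a = - b"
      using imaginary_unit_between[OF pair(3,4,5)] by blast
    obtain L :: "real \<times> (real ^ 6) \<Rightarrow> real ^ 7" where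
      L: "linear L" "\<And>x. norm (L x) = norm x" "L (1, 0) = w" "distr lborel borel L = lborel"
      using obtain_isometry_from_line[OF w(1), where 'a = "real ^ 6"] by auto
    interpret octonion_plane a b w L
      by (rule octonion_plane.intro) (fact pair w L)+
    show False
      using below cauchy_integral_not_bounded_below wave_in_Lp_space[OF H0 pair(1,2)] by blast
  next
    case (line b)
    then show False
      using cauchy_integral_not_onto_of_line onto by metis
  qed
qed

end
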